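(* For any $1\le r\le\infty$, $s\in\mathbb{R}$ and $T>0$, the flow map $S:\hat H^s_r(\mathbb{T})\times(-T,T)\to\hat H^s_r(\mathbb{T})$ of the Cauchy problem for the fourth-order dNLS hierarchy equation $$i\partial_tu-\partial_x^4u=\partial_x\Big(-iu^2\overline{u}_{xx}-4i|u|^2u_{xx}-2i|u_x|^2u-3iu_x^2\overline u-\tfrac{15}{2}|u|^4u_x+\tfrac{5i}{2}|u|^6u\Big)$$ with periodic initial data cannot be thrice continuously differentiable.
   Context: $\mathbb{T}=\mathbb{R}/2\pi\mathbb{Z}$; $\|u\|_{\hat H^s_r(\mathbb{T})}=\|\langle k\rangle^s\hat u(k)\|_{\ell^{r'}_k(\mathbb{Z})}$ with $r'$ the Hölder conjugate of $r$. *)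

theory Defs
  imports "HOL-Analysis.Analysis"
begin

text \<open>Elements of the Fourier--Lebesgue space are represented by their Fourier
coefficient sequences \<open>int \<Rightarrow> complex\<close> (u = sum over k of u k * exp(i k x)).\<close>

type_synonym fseq = "int \<Rightarrow> complex"

definition jbr :: "int \<Rightarrow> real" where
  "jbr k = sqrt (1 + (real_of_int k)\<^sup>2)"

definition conj_exp :: "ereal \<Rightarrow> ereal" where
  "conj_exp r = (if r = \<infinity> then 1 else if r = 1 then \<infinity>
                 else ereal (real_of_ereal r / (real_of_ereal r - 1)))"

definition inHhat :: "real \<Rightarrow> ereal \<Rightarrow> fseq \<Rightarrow> bool" where
  "inHhat s r u = (case conj_exp r of
      ereal p \<Rightarrow> (\<lambda>k. (jbr k powr s * cmod (u k)) powr p) summable_on UNIV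
    | _ \<Rightarrow> bdd_above (range (\<lambda>k. jbr k powr s * cmod (u k))))"

definition Hhat :: "real \<Rightarrow> ereal \<Rightarrow> fseq set" where
  "Hhat s r = {u. inHhat s r u}"

definition hnorm :: "real \<Rightarrow> ereal \<Rightarrow> fseq \<Rightarrow> real" where
  "hnorm s r u = (case conj_exp r of
      ereal p \<Rightarrow> (\<Sum>\<^sub>\<infinity>k. (jbr k powr s * cmod (u k)) powr p) powr (1 / p)
    | _ \<Rightarrow> (SUP k. jbr k powr s * cmod (u k)))"

definition bounded_lin1 :: "real \<Rightarrow> ereal \<Rightarrow> (fseq \<Rightarrow> fseq) \<Rightarrow> bool" where
  "bounded_lin1 s r L \<longleftrightarrow>
     (\<forall>v\<in>Hhat s r. L v \<in> Hhat s r) \<and>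
     (\<forall>a b::real. \<forall>v\<in>Hhat s r. \<forall>w\<in>Hhat s r.
         L (\<lambda>k. a *\<^sub>R v k + b *\<^sub>R w k) = (\<lambda>k. a *\<^sub>R L v k + b *\<^sub>R L w k)) \<and>
     (\<exists>C. \<forall>v\<in>Hhat s r. hnorm s r (L v) \<le> C * hnorm s r v)"

definition bounded_lin2 :: "real \<Rightarrow> ereal \<Rightarrow> (fseq \<Rightarrow> fseq \<Rightarrow> fseq) \<Rightarrow> bool" where
  "bounded_lin2 s r B \<longleftrightarrow>
     (\<forall>v\<in>Hhat s r. bounded_lin1 s r (B v)) \<and>
     (\<forall>w\<in>Hhat s r. bounded_lin1 s r (\<lambda>v. B v w)) \<and>
     (\<exists>C. \<forall>v\<in>Hhat s r. \<forall>w\<in>Hhat s r.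
         hnorm s r (B v w) \<le> C * hnorm s r v * hnorm s r w)"

definition bounded_lin3 :: "real \<Rightarrow> ereal \<Rightarrow> (fseq \<Rightarrow> fseq \<Rightarrow> fseq \<Rightarrow> fseq) \<Rightarrow> bool" where
  "bounded_lin3 s r M \<longleftrightarrow>
     (\<forall>u\<in>Hhat s r. bounded_lin2 s r (M u)) \<and>
     (\<forall>v\<in>Hhat s r. \<forall>w\<in>Hhat s r. bounded_lin1 s r (\<lambda>u. M u v w)) \<and>
     (\<exists>C. \<forall>u\<in>Hhat s r. \<forall>v\<in>Hhat s r. \<forall>w\<in>Hhat s r.
         hnorm s r (M u v w) \<le> C * hnorm s r u * hnorm s r v * hnorm s r w)"

definition C3_on_Hhat :: "real \<Rightarrow> ereal \<Rightarrow> (fseq \<Rightarrow> fseq) \<Rightarrow> bool" where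
  "C3_on_Hhat s r F \<longleftrightarrow>
   (\<forall>x\<in>Hhat s r. F x \<in> Hhat s r) \<and>
   (\<exists>D1 D2 D3.
     (\<forall>x\<in>Hhat s r. bounded_lin1 s r (D1 x) \<and> bounded_lin2 s r (D2 x)
                   \<and> bounded_lin3 s r (D3 x)) \<and>
     (\<forall>x\<in>Hhat s r. \<forall>\<epsilon>>0. \<exists>\<delta>>0. \<forall>h\<in>Hhat s r. hnorm s r h < \<delta> \<longrightarrow>
        hnorm s r (\<lambda>k. F (\<lambda>j. x j + h j) k - F x k - D1 x h k) \<le> \<epsilon> * hnorm s r h) \<and>
     (\<forall>x\<in>Hhat s r. \<forall>\<epsilon>>0. \<exists>\<delta>>0. \<forall>h\<in>Hhat s r. hnorm s r h < \<delta> \<longrightarrow>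
        (\<forall>v\<in>Hhat s r.
          hnorm s r (\<lambda>k. D1 (\<lambda>j. x j + h j) v k - D1 x v k - D2 x h v k)
            \<le> \<epsilon> * hnorm s r h * hnorm s r v)) \<and>
     (\<forall>x\<in>Hhat s r. \<forall>\<epsilon>>0. \<exists>\<delta>>0. \<forall>h\<in>Hhat s r. hnorm s r h < \<delta> \<longrightarrow>
        (\<forall>v\<in>Hhat s r. \<forall>w\<in>Hhat s r.
          hnorm s r (\<lambda>k. D2 (\<lambda>j. x j + h j) v w k - D2 x v w k - D3 x h v w k)
            \<le> \<epsilon> * hnorm s r h * hnorm s r v * hnorm s r w)) \<and>
     (\<forall>x\<in>Hhat s r. \<forall>\<epsilon>>0. \<exists>\<delta>>0. \<forall>h\<in>Hhat s r. hnorm s r h < \<delta> \<longrightarrow>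
        (\<forall>u\<in>Hhat s r. \<forall>v\<in>Hhat s r. \<forall>w\<in>Hhat s r.
          hnorm s r (\<lambda>k. D3 (\<lambda>j. x j + h j) u v w k - D3 x u v w k)
            \<le> \<epsilon> * hnorm s r u * hnorm s r v * hnorm s r w)))"

definition Dx :: "(real \<Rightarrow> complex) \<Rightarrow> real \<Rightarrow> complex" where
  "Dx f = (\<lambda>x. vector_derivative f (at x))"

definition fourier_coeff :: "(real \<Rightarrow> complex) \<Rightarrow> fseq" where
  "fourier_coeff f k =
     integral {0..2*pi} (\<lambda>x. exp (- \<i> * of_int k * of_real x) * f x) / of_real (2*pi)"

definition Nl :: "(real \<Rightarrow> complex) \<Rightarrow> real \<Rightarrow> complex" where
  "Nl u x =
     - \<i> * (u x)\<^sup>2 * cnj (Dx (Dx u) x)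
     - 4 * \<i> * of_real ((cmod (u x))\<^sup>2) * Dx (Dx u) x
     - 2 * \<i> * of_real ((cmod (Dx u x))\<^sup>2) * u x
     - 3 * \<i> * (Dx u x)\<^sup>2 * cnj (u x)
     - (15/2) * of_real ((cmod (u x))^4) * Dx u x
     + (5 * \<i> / 2) * of_real ((cmod (u x))^6) * u x"

definition classical_sol :: "real \<Rightarrow> (real \<Rightarrow> real \<Rightarrow> complex) \<Rightarrow> bool" where
  "classical_sol T u \<longleftrightarrow>
     (\<forall>t\<in>{-T<..<T}. \<forall>x. u t (x + 2*pi) = u t x) \<and>
     (\<forall>t\<in>{-T<..<T}. \<forall>n x.
        ((Dx ^^ n) (u t) has_vector_derivative (Dx ^^ Suc n) (u t) x) (at x)) \<and>
     (\<forall>n. continuous_on ({-T<..<T} \<times> UNIV) (\<lambda>(t, x). (Dx ^^ n) (u t) x)) \<and>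
     (\<forall>t\<in>{-T<..<T}. \<forall>x. \<exists>ut.
        ((\<lambda>\<tau>. u \<tau> x) has_vector_derivative ut) (at t) \<and>
        \<i> * ut - (Dx ^^ 4) (u t) x = Dx (Nl (u t)) x)"

definition is_flow_map :: "real \<Rightarrow> ereal \<Rightarrow> real \<Rightarrow> (fseq \<Rightarrow> real \<Rightarrow> fseq) \<Rightarrow> bool" where
  "is_flow_map s r T S \<longleftrightarrow>
     (\<forall>u0\<in>Hhat s r. \<forall>t\<in>{-T<..<T}. S u0 t \<in> Hhat s r) \<and>
     (\<forall>u0\<in>Hhat s r. S u0 0 = u0) \<and>
     (\<forall>u. classical_sol T u \<longrightarrow>
        (\<forall>t\<in>{-T<..<T}. S (fourier_coeff (u 0)) t = fourier_coeff (u t)))"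

end

theory Submission
  imports Defs "HOL-Real_Asymp.Real_Asymp"
begin

text \<open>Failure already occurs for the continuity of the first derivative at the origin. If
\<open>g' = \<i> ((v + |g|\<^sup>2) g + K)\<close> with \<open>v\<close>, \<open>K\<close> real, then
\<open>E = v |g|\<^sup>2 / 2 + |g|\<^sup>4 / 4 + K Re g\<close> is conserved and, by integrability of the hierarchy,
\<open>g (x - V t)\<close> solves the fourth-order equation with \<open>V = v\<^sup>3 - 6 v E - K\<^sup>2\<close>.
Around every small constant \<open>p\<close> this planar Hamiltonian system has a center, hence small
\<open>2 \<pi> / N\<close>-periodic orbits, whose leading Fourier mode is \<open>N\<close>. So the derivative of the
flow map at the constant \<open>p\<close> rotates (up to a small component at \<open>- N\<close>) the mode \<open>N\<close> with
a frequency which differs from the free one \<open>N\<^sup>4\<close> by about \<open>4 p\<^sup>2 N\<^sup>3\<close>. Taking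
\<open>p\<^sup>2 = \<pi> / (4 t N\<^sup>3)\<close>, the derivatives at \<open>p\<close> and at \<open>0\<close> act on that mode with opposite
signs although \<open>p \<longrightarrow> 0\<close>. Since a mode is compared with itself, the weight
\<open>\<langle>k\<rangle>\<^sup>s\<close> and the exponent \<open>r\<close> play no role.\<close>

section \<open>The sequence spaces\<close>

text \<open>The data of these orbits are not \<open>p\<close> plus a pure mode: apart from
  \<open>N\<close> and \<open>- N\<close> they carry further modes of second order in the amplitude
  \<open>d\<close>. This remainder has to be small in the norm of the space, and mode
  \<open>N\<close> has to be comparable to \<open>d\<close>, so that the remainder disappears on
  division by it. Three limits are nested. For fixed \<open>N\<close> and \<open>p\<close> the
  amplitude tends to 0; the constants of this limit may depend on \<open>N\<close>, \<open>p\<close>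
  and \<open>s\<close>, because each of them multiplies a vanishing factor. Then the Frechet
  tolerance \<open>e\<close> tends to 0, which leaves the bound \<open>20 * C * p\<close> for the
  gap between the two phase factors, with \<open>C\<close> governed by the second derivative at the
  origin. Only then does \<open>N\<close> grow. At this point it is essential that
  \<open>20 * C\<close> depends neither on \<open>N\<close> nor on \<open>p\<close>: the gap tends
  to 2 while the bound tends to 0.\<close>

lemma jbr_ge1: "1 \<le> jbr k"
  by (simp add: jbr_def)

lemma jbr_pos: "0 < jbr k"
  using jbr_ge1[of k] by linarith

lemma jbr_minus [simp]: "jbr (- k) = jbr k"
  by (simp add: jbr_def)

definition sgl :: "int \<Rightarrow> complex \<Rightarrow> fseq" where
  "sgl k a = (\<lambda>j. if j = k then a else 0)"

definition wt :: "real \<Rightarrow> fseq \<Rightarrow> int \<Rightarrow> real" where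
  "wt s u k = jbr k powr s * cmod (u k)"

lemma wt_nonneg: "0 \<le> wt s u k"
  by (simp add: wt_def)

lemma conj_exp_cases:
  assumes "1 \<le> r"
  obtains (infty) "conj_exp r = \<infinity>" | (fin) p where "conj_exp r = ereal p" "1 \<le> p"
proof (cases r)
  case (real x)
  show ?thesis
  proof (cases "x = 1")
    case True
    then show ?thesis using real infty by (simp add: conj_exp_def one_ereal_def)
  next
    case False
    then have "1 < x" using assms real by (simp add: one_ereal_def)
    then have "1 \<le> x / (x - 1)" by (simp add: field_simps)
    then show ?thesis using fin[of "x / (x - 1)"] real False
      by (simp add: conj_exp_def one_ereal_def)
  qed
next
  case PInf
  then show ?thesis using fin[of 1] by (simp add: conj_exp_def one_ereal_def)
next
  case MInf
  then show ?thesis using assms by simp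
qed

lemma Hhat_infty:
  assumes "conj_exp r = \<infinity>"
  shows "u \<in> Hhat s r \<longleftrightarrow> bdd_above (range (wt s u))"
    and "hnorm s r u = (SUP k. wt s u k)"
  using assms by (simp_all add: Hhat_def inHhat_def hnorm_def wt_def[abs_def])

lemma Hhat_fin:
  assumes "conj_exp r = ereal p"
  shows "u \<in> Hhat s r \<longleftrightarrow> (\<lambda>k. wt s u k powr p) summable_on UNIV"
    and "hnorm s r u = (\<Sum>\<^sub>\<infinity>k. wt s u k powr p) powr (1 / p)"
  using assms by (simp_all add: Hhat_def inHhat_def hnorm_def wt_def[abs_def])

text \<open>Norm estimates are passed to a single Fourier mode through this bound; the comparison of
  derivatives then takes place at one mode, where the weight cancels.\<close>

lemma wt_le_hnorm:
  assumes r: "1 \<le> r" and u: "u \<in> Hhat s r"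
  shows "wt s u k \<le> hnorm s r u"
  using r
proof (cases rule: conj_exp_cases)
  case infty
  then show ?thesis using u by (simp add: Hhat_infty cSUP_upper)
next
  case (fin p)
  have S: "(\<lambda>k. wt s u k powr p) summable_on UNIV"
    using u fin by (simp add: Hhat_fin)
  have "(\<Sum>\<^sub>\<infinity>j\<in>{k}. wt s u j powr p) \<le> (\<Sum>\<^sub>\<infinity>j. wt s u j powr p)"
    by (rule infsum_mono2) (use S in auto)
  then have "wt s u k powr p \<le> (\<Sum>\<^sub>\<infinity>j. wt s u j powr p)" by simp
  then have "(wt s u k powr p) powr (1/p) \<le> (\<Sum>\<^sub>\<infinity>j. wt s u j powr p) powr (1/p)"
    using fin by (intro powr_mono2) auto
  then show ?thesis using fin by (simp add: Hhat_fin powr_powr wt_nonneg)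
qed

lemma hnorm_nonneg:
  assumes r: "1 \<le> r" and u: "u \<in> Hhat s r"
  shows "0 \<le> hnorm s r u"
  using wt_le_hnorm[OF r u, of 0] wt_nonneg[of s u 0] by linarith

text \<open>A cheap replacement for Minkowski's inequality: domination by a maximum passes both to
  suprema and to sums of \<open>p\<close>-th powers, and \<open>2 * 2 powr (1/p) \<le> 4\<close>
  because \<open>1 \<le> p\<close>. The lost constant is harmless, as only comparability of norms
  matters later.\<close>

lemma Hhat_hnorm_le:
  assumes r: "1 \<le> r"
    and le: "\<And>k. wt s u k \<le> 2 * max (wt s v k) (wt s w k)"
    and v: "v \<in> Hhat s r" and w: "w \<in> Hhat s r"
  shows "u \<in> Hhat s r \<and> hnorm s r u \<le> 4 * (hnorm s r v + hnorm s r w)"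
  using r
proof (cases rule: conj_exp_cases)
  case infty
  have "wt s u k \<le> 2 * (hnorm s r v + hnorm s r w)" for k
    using le[of k] wt_le_hnorm[OF r v, of k] wt_le_hnorm[OF r w, of k]
      hnorm_nonneg[OF r v] hnorm_nonneg[OF r w] by (auto simp: max_def split: if_splits)
  then have "bdd_above (range (wt s u))" "(SUP k. wt s u k) \<le> 2 * (hnorm s r v + hnorm s r w)"
    by (auto intro!: bdd_aboveI cSUP_least)
  then show ?thesis
    using infty hnorm_nonneg[OF r v] hnorm_nonneg[OF r w] by (simp add: Hhat_infty)
next
  case (fin p)
  define X where "X = (\<Sum>\<^sub>\<infinity>k. wt s v k powr p)"
  define Y where "Y = (\<Sum>\<^sub>\<infinity>k. wt s w k powr p)"
  have Sv: "(\<lambda>k. wt s v k powr p) summable_on UNIV" and Sw: "(\<lambda>k. wt s w k powr p) summable_on UNIV"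
    using v w fin by (simp_all add: Hhat_fin)
  have pw: "wt s u k powr p \<le> 2 powr p * (wt s v k powr p + wt s w k powr p)" for k
  proof -
    have "wt s u k powr p \<le> (2 * max (wt s v k) (wt s w k)) powr p"
      using fin le wt_nonneg by (intro powr_mono2) auto
    also have "\<dots> = 2 powr p * max (wt s v k) (wt s w k) powr p"
      using wt_nonneg by (simp add: powr_mult)
    also have "\<dots> \<le> 2 powr p * (wt s v k powr p + wt s w k powr p)"
      by (simp add: max_def)
    finally show ?thesis .
  qed
  have Sb: "(\<lambda>k. 2 powr p * (wt s v k powr p + wt s w k powr p)) summable_on UNIV"
    by (intro summable_on_cmult_right summable_on_add Sv Sw)
  have Su: "(\<lambda>k. wt s u k powr p) summable_on UNIV"
    by (rule summable_on_comparison_test[OF Sb]) (use pw in auto)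
  have "(\<Sum>\<^sub>\<infinity>k. wt s u k powr p) \<le> (\<Sum>\<^sub>\<infinity>k. 2 powr p * (wt s v k powr p + wt s w k powr p))"
    by (intro infsum_mono Su Sb) (use pw in auto)
  also have "\<dots> = 2 powr p * (X + Y)"
    unfolding X_def Y_def using Sv Sw by (simp add: infsum_cmult_right' infsum_add)
  also have "\<dots> \<le> 2 powr p * (2 * max X Y)"
    by (intro mult_left_mono) auto
  finally have "(\<Sum>\<^sub>\<infinity>k. wt s u k powr p) \<le> 2 powr p * (2 * max X Y)" .
  then have "(\<Sum>\<^sub>\<infinity>k. wt s u k powr p) powr (1/p) \<le> (2 powr p * (2 * max X Y)) powr (1/p)"
    using fin by (intro powr_mono2) (auto intro!: infsum_nonneg)
  also have "\<dots> = 2 * 2 powr (1/p) * max X Y powr (1/p)"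
  proof -
    have "0 \<le> max X Y" unfolding X_def by (auto intro!: infsum_nonneg simp: le_max_iff_disj)
    then show ?thesis using fin by (simp add: powr_mult powr_powr)
  qed
  also have "\<dots> \<le> 2 * 2 powr 1 * (X powr (1/p) + Y powr (1/p))"
    using fin by (intro mult_mono powr_mono) (auto simp: max_def)
  finally show ?thesis
    using Su fin by (simp add: Hhat_fin X_def Y_def)
qed

lemma Hhat_add:
  assumes r: "1 \<le> r" and v: "v \<in> Hhat s r" and w: "w \<in> Hhat s r"
  shows "(\<lambda>k. v k + w k) \<in> Hhat s r"
    and "hnorm s r (\<lambda>k. v k + w k) \<le> 4 * (hnorm s r v + hnorm s r w)"
proof -
  have "wt s (\<lambda>k. v k + w k) k \<le> 2 * max (wt s v k) (wt s w k)" for k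
  proof -
    have "wt s (\<lambda>k. v k + w k) k \<le> jbr k powr s * (cmod (v k) + cmod (w k))"
      unfolding wt_def by (intro mult_left_mono norm_triangle_ineq) auto
    then show ?thesis by (simp add: wt_def algebra_simps max_def)
  qed
  from Hhat_hnorm_le[OF r this v w]
  show "(\<lambda>k. v k + w k) \<in> Hhat s r"
    and "hnorm s r (\<lambda>k. v k + w k) \<le> 4 * (hnorm s r v + hnorm s r w)"
    by auto
qed

lemma Hhat_uminus:
  assumes "w \<in> Hhat s r"
  shows "(\<lambda>k. - w k) \<in> Hhat s r"
  using assms by (cases "conj_exp r") (simp_all add: Hhat_def inHhat_def)

lemma Hhat_diff:
  assumes r: "1 \<le> r" and v: "v \<in> Hhat s r" and w: "w \<in> Hhat s r"
  shows "(\<lambda>k. v k - w k) \<in> Hhat s r"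
  using Hhat_add(1)[OF r v Hhat_uminus[OF w]] by simp

lemma jbr_summable: "(\<lambda>k. jbr k powr (- 2)) summable_on UNIV"
proof -
  have 1: "(\<lambda>n::nat. inverse ((real n)\<^sup>2)) summable_on UNIV"
    by (subst summable_on_UNIV_nonneg_real_iff) (auto intro: inverse_power_summable)
  \<comment> \<open>In HOL \<open>inverse 0 = 0\<close>, so the comparison with the inverse squares
    needs an extra unit at \<open>k = 0\<close>.\<close>
  have b: "jbr k powr (-2) \<le> inverse ((real_of_int k)\<^sup>2) + (if k = 0 then 1 else 0)" for k
  proof -
    have "jbr k powr (-2) = inverse ((jbr k)\<^sup>2)"
      using jbr_pos[of k] by (simp add: powr_minus)
    also have "\<dots> = inverse (1 + (real_of_int k)\<^sup>2)"
      by (simp add: jbr_def)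
    finally have "jbr k powr (-2) = inverse (1 + (real_of_int k)\<^sup>2)" .
    then show ?thesis by (auto intro!: le_imp_inverse_le)
  qed
  have 2: "(\<lambda>k. inverse ((real_of_int k)\<^sup>2)) summable_on {0..}"
  proof -
    have "bij_betw int UNIV {0..}"
      by (rule bij_betwI[of _ _ _ nat]) auto
    from summable_on_reindex_bij_betw[OF this, of "\<lambda>k. inverse ((real_of_int k)\<^sup>2)"] 1
    show ?thesis by simp
  qed
  have 3: "(\<lambda>k. inverse ((real_of_int k)\<^sup>2)) summable_on {..0}"
  proof -
    have "bij_betw (\<lambda>n. - int n) UNIV {..0}"
      by (rule bij_betwI[of _ _ _ "\<lambda>k. nat (- k)"]) auto
    from summable_on_reindex_bij_betw[OF this, of "\<lambda>k. inverse ((real_of_int k)\<^sup>2)"] 1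
    show ?thesis by simp
  qed
  have "{..0} \<union> {0..} = (UNIV::int set)" by auto
  with summable_on_union[OF 3 2]
  have 4: "(\<lambda>k. inverse ((real_of_int k)\<^sup>2)) summable_on UNIV" by simp
  have "(\<lambda>k. if k = 0 then 1 else 0 :: real) summable_on (UNIV::int set)"
    by (rule finite_nonzero_values_imp_summable_on) (auto)
  from summable_on_add[OF 4 this]
  show ?thesis by (rule summable_on_comparison_test) (use b in auto)
qed

text \<open>One decay rate serves all \<open>r\<close>: after weighting, the coefficients are at
  most \<open>M * jbr k powr (- 2)\<close>, which is bounded and summable, and raising
  \<open>jbr k powr (- 2) \<le> 1\<close> to a power \<open>p \<ge> 1\<close> only makes it smaller.
  Since \<open>C\<close> does not depend on \<open>u\<close>, whole families are bounded at
  once.\<close>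

lemma Hhat_decay:
  assumes r: "1 \<le> r"
  obtains C where "0 < C"
    and "\<And>u M. 0 \<le> M \<Longrightarrow> (\<And>k. cmod (u k) \<le> M * jbr k powr (- s - 2))
           \<Longrightarrow> u \<in> Hhat s r \<and> hnorm s r u \<le> C * M"
proof -
  have w: "wt s u k \<le> M * jbr k powr (- 2)"
    if "cmod (u k) \<le> M * jbr k powr (- s - 2)" for u M k
  proof -
    have "wt s u k \<le> jbr k powr s * (M * jbr k powr (- s - 2))"
      unfolding wt_def using that by (intro mult_left_mono) auto
    also have "\<dots> = M * (jbr k powr s * jbr k powr (- s - 2))" by simp
    also have "\<dots> = M * jbr k powr (- 2)" by (simp flip: powr_add)
    finally show ?thesis .
  qed
  have j1: "jbr k powr (- 2) \<le> 1" for k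
    using powr_mono[of "-2" 0 "jbr k"] jbr_ge1[of k] by simp
  from r show ?thesis
  proof (cases rule: conj_exp_cases)
    case infty
    show ?thesis
    proof (rule that[of 1])
      fix u :: fseq and M :: real
      assume M: "0 \<le> M" and u: "\<And>k. cmod (u k) \<le> M * jbr k powr (- s - 2)"
      have "wt s u k \<le> M" for k
        using w[where u=u and M=M and k=k, OF u] mult_left_mono[OF j1[of k] M] by simp
      then show "u \<in> Hhat s r \<and> hnorm s r u \<le> 1 * M"
        using infty by (auto simp: Hhat_infty intro!: bdd_aboveI cSUP_least)
    qed simp
  next
    case (fin p)
    define Z where "Z = (\<Sum>\<^sub>\<infinity>k. jbr k powr (- 2))"
    have "jbr 0 powr (-2) \<le> Z"
    proof -
      have "(\<Sum>\<^sub>\<infinity>j\<in>{0}. jbr j powr (-2)) \<le> Z"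
        unfolding Z_def by (rule infsum_mono2) (use jbr_summable in auto)
      then show ?thesis by simp
    qed
    then have Z: "0 < Z" by (simp add: jbr_def)
    show ?thesis
    proof (rule that[of "Z powr (1/p)"])
      show "0 < Z powr (1/p)" using Z by simp
      fix u :: fseq and M :: real
      assume M: "0 \<le> M" and u: "\<And>k. cmod (u k) \<le> M * jbr k powr (- s - 2)"
      have pw: "wt s u k powr p \<le> M powr p * jbr k powr (- 2)" for k
      proof -
        have "wt s u k powr p \<le> (M * jbr k powr (- 2)) powr p"
          using fin wt_nonneg w[where u=u and M=M and k=k, OF u] by (intro powr_mono2) auto
        also have "\<dots> = M powr p * (jbr k powr (- 2)) powr p"
          using M by (simp add: powr_mult)
        also have "\<dots> \<le> M powr p * (jbr k powr (- 2)) powr 1"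
          using fin j1[of k] jbr_pos[of k] by (intro mult_left_mono powr_mono') auto
        finally show ?thesis using jbr_pos[of k] by simp
      qed
      have Sb: "(\<lambda>k. M powr p * jbr k powr (- 2)) summable_on UNIV"
        by (intro summable_on_cmult_right jbr_summable)
      have Su: "(\<lambda>k. wt s u k powr p) summable_on UNIV"
        by (rule summable_on_comparison_test[OF Sb]) (use pw in auto)
      have "(\<Sum>\<^sub>\<infinity>k. wt s u k powr p) \<le> (\<Sum>\<^sub>\<infinity>k. M powr p * jbr k powr (- 2))"
        by (intro infsum_mono Su Sb) (use pw in auto)
      also have "\<dots> = M powr p * Z"
        unfolding Z_def by (simp add: infsum_cmult_right')
      finally have "(\<Sum>\<^sub>\<infinity>k. wt s u k powr p) powr (1/p) \<le> (M powr p * Z) powr (1/p)"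
        using fin by (intro powr_mono2) (auto intro!: infsum_nonneg)
      also have "\<dots> = Z powr (1/p) * M"
        using fin M Z by (simp add: powr_mult powr_powr)
      finally show "u \<in> Hhat s r \<and> hnorm s r u \<le> Z powr (1/p) * M"
        using Su fin by (simp add: Hhat_fin)
    qed
  qed
qed

lemma sgl_Hhat:
  assumes r: "1 \<le> r"
  shows "sgl k a \<in> Hhat s r" and "hnorm s r (sgl k a) = jbr k powr s * cmod a"
proof -
  have w: "wt s (sgl k a) = (\<lambda>j. if j = k then jbr k powr s * cmod a else 0)"
    by (auto simp: wt_def sgl_def)
  have "sgl k a \<in> Hhat s r \<and> hnorm s r (sgl k a) = jbr k powr s * cmod a"
    using r
  proof (cases rule: conj_exp_cases)
    case infty
    have b: "bdd_above (range (wt s (sgl k a)))"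
      unfolding w by (rule bdd_aboveI[of _ "jbr k powr s * cmod a"]) (auto)
    have "(SUP j. wt s (sgl k a) j) = jbr k powr s * cmod a"
    proof (rule cSup_eq_maximum)
      show "jbr k powr s * cmod a \<in> range (wt s (sgl k a))"
        unfolding w by (rule image_eqI[of _ _ k]) auto
    qed (auto simp: w)
    then show ?thesis using b infty by (simp add: Hhat_infty)
  next
    case (fin p)
    have e: "(\<lambda>j. wt s (sgl k a) j powr p) = (\<lambda>j. if j = k then (jbr k powr s * cmod a) powr p else 0)"
      by (auto simp: w)
    have "(\<lambda>j. wt s (sgl k a) j powr p) summable_on UNIV"
      unfolding e by (rule finite_nonzero_values_imp_summable_on) auto
    moreover have "(\<Sum>\<^sub>\<infinity>j. wt s (sgl k a) j powr p) = (jbr k powr s * cmod a) powr p"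
      unfolding e by (subst infsum_cong_neutral[where T="{k}" and g="\<lambda>_. (jbr k powr s * cmod a) powr p"]) auto
    ultimately show ?thesis using fin by (simp add: Hhat_fin powr_powr)
  qed
  then show "sgl k a \<in> Hhat s r" "hnorm s r (sgl k a) = jbr k powr s * cmod a" by auto
qed

section \<open>Bounded real-linear maps and consequences of differentiability\<close>

lemma bounded_lin1D:
  assumes L: "bounded_lin1 s r L" and v: "v \<in> Hhat s r"
  shows "L v \<in> Hhat s r"
    and "w \<in> Hhat s r \<Longrightarrow> L (\<lambda>k. v k + w k) = (\<lambda>k. L v k + L w k)"
    and "L (\<lambda>k. c *\<^sub>R v k) = (\<lambda>k. c *\<^sub>R L v k)"
proof -
  have lin: "L (\<lambda>k. a *\<^sub>R x k + b *\<^sub>R y k) = (\<lambda>k. a *\<^sub>R L x k + b *\<^sub>R L y k)"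
    if "x \<in> Hhat s r" "y \<in> Hhat s r" for a b :: real and x y
    using L that unfolding bounded_lin1_def by blast
  show "L v \<in> Hhat s r" using L v unfolding bounded_lin1_def by blast
  show "L (\<lambda>k. v k + w k) = (\<lambda>k. L v k + L w k)" if "w \<in> Hhat s r"
    using lin[OF v that, of 1 1] by simp
  show "L (\<lambda>k. c *\<^sub>R v k) = (\<lambda>k. c *\<^sub>R L v k)"
    using lin[OF v v, of c 0] by simp
qed

lemma bounded_lin1_bound:
  assumes r: "1 \<le> r" and L: "bounded_lin1 s r L"
  obtains C where "0 \<le> C" and "\<And>v k. v \<in> Hhat s r \<Longrightarrow> wt s (L v) k \<le> C * hnorm s r v"
proof -
  from L obtain C where C: "\<And>v. v \<in> Hhat s r \<Longrightarrow> hnorm s r (L v) \<le> C * hnorm s r v"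
    unfolding bounded_lin1_def by blast
  show ?thesis
  proof (rule that[of "\<bar>C\<bar>"])
    fix v k assume v: "v \<in> Hhat s r"
    have "wt s (L v) k \<le> C * hnorm s r v"
      using wt_le_hnorm[OF r bounded_lin1D(1)[OF L v]] C[OF v] by (rule order_trans)
    also have "\<dots> \<le> \<bar>C\<bar> * hnorm s r v"
      using hnorm_nonneg[OF r v] by (intro mult_right_mono) auto
    finally show "wt s (L v) k \<le> \<bar>C\<bar> * hnorm s r v" .
  qed simp
qed

lemma sgl_0 [simp]: "sgl k 0 = (\<lambda>_. 0)"
  by (auto simp: sgl_def)

lemma zero_Hhat: "1 \<le> r \<Longrightarrow> (\<lambda>_. 0) \<in> Hhat s r"
  using sgl_Hhat(1)[of r 0 0 s] by simp

lemma wt_diff_ineq: "wt s (\<lambda>k. u k) k \<le> wt s (\<lambda>k. u k - v k) k + wt s v k"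
proof -
  have "cmod (u k) \<le> cmod (u k - v k) + cmod (v k)"
    by (metis diff_add_cancel norm_triangle_ineq)
  then have "jbr k powr s * cmod (u k) \<le> jbr k powr s * (cmod (u k - v k) + cmod (v k))"
    by (intro mult_left_mono) auto
  then show ?thesis by (simp add: wt_def algebra_simps)
qed

text \<open>The form of differentiability that will be contradicted, stated coefficientwise. The
  Lipschitz bound for \<open>D1\<close> at the origin comes from expanding \<open>D1\<close> there
  with tolerance 1: the bounded bilinear map \<open>D2\<close> at 0 contributes its constant, the
  error contributes the additional 1.\<close>

lemma C3_on_HhatE:
  assumes r: "1 \<le> r" and F: "C3_on_Hhat s r F"
  obtains D1 C d where
    "\<And>x. x \<in> Hhat s r \<Longrightarrow> bounded_lin1 s r (D1 x)"
    "\<And>x e. x \<in> Hhat s r \<Longrightarrow> 0 < e \<Longrightarrow> \<exists>d>0. \<forall>h\<in>Hhat s r. hnorm s r h < d \<longrightarrow>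
        (\<forall>k. wt s (\<lambda>k. F (\<lambda>j. x j + h j) k - F x k - D1 x h k) k \<le> e * hnorm s r h)"
    "0 < d" "0 \<le> C"
    "\<And>x v k. x \<in> Hhat s r \<Longrightarrow> hnorm s r x < d \<Longrightarrow> v \<in> Hhat s r \<Longrightarrow>
        wt s (\<lambda>k. D1 x v k - D1 (\<lambda>_. 0) v k) k \<le> C * hnorm s r x * hnorm s r v"
proof -
  let ?H = "Hhat s r" and ?n = "hnorm s r" and ?z = "\<lambda>_::int. 0::complex"
  have Fin: "F x \<in> ?H" if "x \<in> ?H" for x
    using F that unfolding C3_on_Hhat_def by blast
  from F obtain D1 D2 D3 where
    b: "\<forall>x\<in>?H. bounded_lin1 s r (D1 x) \<and> bounded_lin2 s r (D2 x) \<and> bounded_lin3 s r (D3 x)"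
    and d1: "\<forall>x\<in>?H. \<forall>e>0. \<exists>d>0. \<forall>h\<in>?H. ?n h < d \<longrightarrow>
        ?n (\<lambda>k. F (\<lambda>j. x j + h j) k - F x k - D1 x h k) \<le> e * ?n h"
    and d2: "\<forall>x\<in>?H. \<forall>e>0. \<exists>d>0. \<forall>h\<in>?H. ?n h < d \<longrightarrow> (\<forall>v\<in>?H.
        ?n (\<lambda>k. D1 (\<lambda>j. x j + h j) v k - D1 x v k - D2 x h v k) \<le> e * ?n h * ?n v)"
    unfolding C3_on_Hhat_def 
    apply (elim conjE exE)
    apply (rule that)
      apply assumption+
    done
  have z: "?z \<in> ?H" using zero_Hhat[OF r] .
  have B2: "bounded_lin2 s r (D2 ?z)" using b z by blast
  then obtain C where C: "\<And>v w. v \<in> ?H \<Longrightarrow> w \<in> ?H \<Longrightarrow> ?n (D2 ?z v w) \<le> C * ?n v * ?n w"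
    unfolding bounded_lin2_def by blast
  from d2[rule_format, OF z zero_less_one] obtain d where d: "0 < d" and dd: "\<And>h v. h \<in> ?H \<Longrightarrow> ?n h < d \<Longrightarrow> v \<in> ?H \<Longrightarrow>
      ?n (\<lambda>k. D1 h v k - D1 ?z v k - D2 ?z h v k) \<le> 1 * ?n h * ?n v"
    by auto
  show ?thesis
  proof (rule that[of D1 d "\<bar>C\<bar> + 1"])
    show "bounded_lin1 s r (D1 x)" if "x \<in> ?H" for x using b that by blast
  next
    fix x and e :: real
    assume x: "x \<in> ?H" and e: "0 < e"
    from d1 x e obtain d where d: "0 < d" and dd: "\<And>h. h \<in> ?H \<Longrightarrow> ?n h < d \<Longrightarrow>
        ?n (\<lambda>k. F (\<lambda>j. x j + h j) k - F x k - D1 x h k) \<le> e * ?n h"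
      by blast
    show "\<exists>d>0. \<forall>h\<in>?H. ?n h < d \<longrightarrow>
        (\<forall>k. wt s (\<lambda>k. F (\<lambda>j. x j + h j) k - F x k - D1 x h k) k \<le> e * ?n h)"
    proof (intro exI[of _ d] conjI d ballI impI allI)
      fix h k assume h: "h \<in> ?H" "?n h < d"
      have "(\<lambda>j. x j + h j) \<in> ?H" using Hhat_add(1)[OF r x h(1)] .
      moreover have "D1 x h \<in> ?H" using b x h bounded_lin1D(1) by blast
      ultimately have "(\<lambda>k. F (\<lambda>j. x j + h j) k - F x k - D1 x h k) \<in> ?H"
        by (intro Hhat_diff r Fin x)
      from wt_le_hnorm[OF r this] dd[OF h]
      show "wt s (\<lambda>k. F (\<lambda>j. x j + h j) k - F x k - D1 x h k) k \<le> e * ?n h"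
        by (rule order_trans)
    qed
  next
    fix x v k assume x: "x \<in> ?H" "?n x < d" and v: "v \<in> ?H"
    have D2: "D2 ?z x v \<in> ?H"
      using B2 x v unfolding bounded_lin2_def bounded_lin1_def by blast
    have D1: "D1 x v \<in> ?H" "D1 ?z v \<in> ?H" using b x v z bounded_lin1D(1) by blast+
    have "(\<lambda>k. D1 x v k - D1 ?z v k - D2 ?z x v k) \<in> ?H"
      by (intro Hhat_diff r D1 D2)
    from wt_le_hnorm[OF r this, of k] dd[OF x v]
    have 1: "wt s (\<lambda>k. D1 x v k - D1 ?z v k - D2 ?z x v k) k \<le> ?n x * ?n v" by simp
    have 2: "wt s (D2 ?z x v) k \<le> \<bar>C\<bar> * ?n x * ?n v"
    proof -
      have "wt s (D2 ?z x v) k \<le> C * (?n x * ?n v)"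
        using order_trans[OF wt_le_hnorm[OF r D2, of k] C[OF x(1) v]] by (simp add: mult.assoc)
      also have "\<dots> \<le> \<bar>C\<bar> * (?n x * ?n v)"
        using hnorm_nonneg[OF r x(1)] hnorm_nonneg[OF r v] by (intro mult_right_mono) auto
      finally show ?thesis by (simp add: mult.assoc)
    qed
    show "wt s (\<lambda>k. D1 x v k - D1 ?z v k) k \<le> (\<bar>C\<bar> + 1) * ?n x * ?n v"
      using wt_diff_ineq[of s "\<lambda>k. D1 x v k - D1 ?z v k" k "D2 ?z x v"] 1 2
      by (simp add: algebra_simps)
  qed (use d in auto)
qed

section \<open>Travelling waves\<close>

text \<open>Families \<open>f n = O(w n ^ j)\<close> of polynomials in \<open>h\<close> and its conjugate. When \<open>h\<close> solves an
autonomous polynomial equation, differentiation preserves the order \<open>j\<close>; this yields uniform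
bounds on all derivatives, hence on Fourier coefficients, from a bound on \<open>h\<close> alone.\<close>

inductive graded_alg :: "(nat \<Rightarrow> real) \<Rightarrow> (nat \<Rightarrow> real \<Rightarrow> complex) \<Rightarrow> nat \<Rightarrow> (nat \<Rightarrow> real \<Rightarrow> complex) \<Rightarrow> bool"
  for w :: "nat \<Rightarrow> real" and h :: "nat \<Rightarrow> real \<Rightarrow> complex" where
  const: "(\<And>n. cmod (a n) \<le> M * w n ^ j) \<Longrightarrow> graded_alg w h j (\<lambda>n x. a n)"
| self: "graded_alg w h 1 h"
| cnj_self: "graded_alg w h 1 (\<lambda>n x. cnj (h n x))"
| add: "graded_alg w h j f \<Longrightarrow> graded_alg w h j g \<Longrightarrow> graded_alg w h j (\<lambda>n x. f n x + g n x)"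
| mult: "graded_alg w h i f \<Longrightarrow> graded_alg w h j g \<Longrightarrow> graded_alg w h (i + j) (\<lambda>n x. f n x * g n x)"
| weaken: "graded_alg w h (Suc j) f \<Longrightarrow> graded_alg w h j f"

lemma graded_alg_bound:
  assumes "graded_alg w h j f"
    and w: "\<And>n. 0 \<le> w n" "\<And>n. w n \<le> 1"
    and h: "\<And>n x. cmod (h n x) \<le> B * w n"
  shows "\<exists>M\<ge>0. \<forall>n x. cmod (f n x) \<le> M * w n ^ j"
  using assms(1)
proof induction
  case (const a M j)
  have "cmod (a n) \<le> \<bar>M\<bar> * w n ^ j" for n
    using const[of n] w(1)[of n] by (meson abs_ge_self mult_right_mono order_trans zero_le_power)
  then show ?case by (intro exI[of _ "\<bar>M\<bar>"]) auto
next
  case self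
  have "cmod (h n x) \<le> \<bar>B\<bar> * w n ^ 1" for n x
    using h[of n x] w(1)[of n] by (simp, meson abs_ge_self mult_right_mono order_trans)
  then show ?case by (intro exI[of _ "\<bar>B\<bar>"]) auto
next
  case cnj_self
  have "cmod (cnj (h n x)) \<le> \<bar>B\<bar> * w n ^ 1" for n x
    using h[of n x] w(1)[of n] by (simp, meson abs_ge_self mult_right_mono order_trans)
  then show ?case by (intro exI[of _ "\<bar>B\<bar>"]) auto
next
  case (add j f g)
  then obtain M M' where M: "M \<ge> 0" "\<And>n x. cmod (f n x) \<le> M * w n ^ j"
    and M': "M' \<ge> 0" "\<And>n x. cmod (g n x) \<le> M' * w n ^ j" by blast
  have "cmod (f n x + g n x) \<le> (M + M') * w n ^ j" for n x
    using norm_triangle_ineq[of "f n x" "g n x"] M(2)[of n x] M'(2)[of n x]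
    by (simp add: algebra_simps)
  then show ?case using M M' by (intro exI[of _ "M + M'"]) auto
next
  case (mult i f j g)
  then obtain M M' where M: "M \<ge> 0" "\<And>n x. cmod (f n x) \<le> M * w n ^ i"
    and M': "M' \<ge> 0" "\<And>n x. cmod (g n x) \<le> M' * w n ^ j" by blast
  have "cmod (f n x * g n x) \<le> (M * w n ^ i) * (M' * w n ^ j)" for n x
    unfolding norm_mult using M M' w by (intro mult_mono) auto
  then show ?case using M M' by (intro exI[of _ "M * M'"]) (auto simp: power_add ac_simps)
next
  case (weaken j f)
  then obtain M where M: "M \<ge> 0" "\<And>n x. cmod (f n x) \<le> M * w n ^ Suc j" by blast
  have "cmod (f n x) \<le> M * w n ^ j" for n x
  proof -
    have "w n ^ Suc j \<le> w n ^ j" using w[of n] by (intro power_decreasing) auto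
    then show ?thesis using M(2)[of n x] M(1) by (meson mult_left_mono order_trans)
  qed
  then show ?case using M by (intro exI[of _ M]) auto
qed

lemma graded_alg_mono: "graded_alg w h j f \<Longrightarrow> i \<le> j \<Longrightarrow> graded_alg w h i f"
  by (rotate_tac, induction rule: inc_induct) (auto intro: graded_alg.weaken)

lemma graded_alg_cnj: "graded_alg w h j f \<Longrightarrow> graded_alg w h j (\<lambda>n x. cnj (f n x))"
proof (induction rule: graded_alg.induct)
  case (const a M j)
  then show ?case by (intro graded_alg.const[of _ M]) simp
qed (auto intro: graded_alg.intros simp del: One_nat_def)

text \<open>In the product rule a factor \<open>h\<close> or its conjugate is exchanged for its
  derivative, which again has order 1. Thus differentiation loses no power of
  \<open>w\<close>.\<close>

lemma graded_alg_vector_derivative: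
  assumes "graded_alg w h j f"
    and h': "graded_alg w h 1 h'" "\<And>n x. (h n has_vector_derivative h' n x) (at x)"
  shows "\<exists>f'. graded_alg w h j f' \<and> (\<forall>n x. (f n has_vector_derivative f' n x) (at x))"
  using assms(1)
proof induction
  case (const a M j)
  show ?case
    by (intro exI[of _ "\<lambda>n x. 0"] conjI graded_alg.const[of _ 0]) auto
next
  case self
  then show ?case using h' by blast
next
  case cnj_self
  then show ?case using h' graded_alg_cnj
    by (intro exI[of _ "\<lambda>n x. cnj (h' n x)"]) (auto intro: has_vector_derivative_cnj)
next
  case (add j f g)
  then obtain f' g' where "graded_alg w h j f'" "graded_alg w h j g'"
    "\<And>n x. (f n has_vector_derivative f' n x) (at x)" "\<And>n x. (g n has_vector_derivative g' n x) (at x)"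
    by blast
  then show ?case
    by (intro exI[of _ "\<lambda>n x. f' n x + g' n x"]) (auto intro: graded_alg.add has_vector_derivative_add)
next
  case (mult i f j g)
  then obtain f' g' where "graded_alg w h i f'" "graded_alg w h j g'"
    "\<And>n x. (f n has_vector_derivative f' n x) (at x)" "\<And>n x. (g n has_vector_derivative g' n x) (at x)"
    by blast
  with mult.hyps show ?case
    by (intro exI[of _ "\<lambda>n x. f n x * g' n x + f' n x * g n x"])
      (auto intro!: graded_alg.add graded_alg.mult has_vector_derivative_mult)
qed (blast intro: graded_alg.weaken)

lemma Dx_eq: "(f has_vector_derivative f') (at x) \<Longrightarrow> Dx f x = f'"
  by (simp add: Dx_def vector_derivative_at)

lemma graded_alg_Dx:
  assumes f: "graded_alg w h j f"
    and h': "graded_alg w h 1 h'" "\<And>n x. (h n has_vector_derivative h' n x) (at x)"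
  shows "graded_alg w h j (\<lambda>n. (Dx ^^ m) (f n))"
    and "((Dx ^^ m) (f n) has_vector_derivative (Dx ^^ Suc m) (f n) x) (at x)"
proof -
  show A: "graded_alg w h j (\<lambda>n. (Dx ^^ m) (f n))" for m
  proof (induction m)
    case (Suc m)
    from graded_alg_vector_derivative[OF Suc h'] obtain f' where f': "graded_alg w h j f'"
      "\<And>n x. ((Dx ^^ m) (f n) has_vector_derivative f' n x) (at x)" by blast
    then have "(\<lambda>n. (Dx ^^ Suc m) (f n)) = f'" by (auto simp: Dx_eq fun_eq_iff)
    then show ?case using f' by simp
  qed (use f in simp)
  from graded_alg_vector_derivative[OF A h', of m] obtain f' where f':
    "\<And>n x. ((Dx ^^ m) (f n) has_vector_derivative f' n x) (at x)" by blast
  then show "((Dx ^^ m) (f n) has_vector_derivative (Dx ^^ Suc m) (f n) x) (at x)"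
    using f'[of n x] by (simp add: Dx_eq[OF f'])
qed

section \<open>Profiles and the travelling waves they generate\<close>

lemma has_vector_derivative_shift:
  fixes f :: "real \<Rightarrow> complex"
  shows "((\<lambda>x. f (x - a)) has_vector_derivative d) (at x)
           \<longleftrightarrow> (f has_vector_derivative d) (at (x - a))"
proof
  have *: "((\<lambda>x. f (x - a)) has_vector_derivative d) (at x)"
    if "(f has_vector_derivative d) (at (x - a))" for f :: "real \<Rightarrow> complex" and x a
  proof -
    have "((\<lambda>x. x - a) has_vector_derivative 1) (at x)"
      by (auto intro!: derivative_eq_intros)
    from vector_diff_chain_at[OF this that] show ?thesis by (simp add: o_def)
  qed
  then show "(f has_vector_derivative d) (at (x - a)) \<Longrightarrow>
      ((\<lambda>x. f (x - a)) has_vector_derivative d) (at x)" .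
  assume "((\<lambda>x. f (x - a)) has_vector_derivative d) (at x)"
  then have "((\<lambda>x. f (x - a)) has_vector_derivative d) (at (x - a - - a))" by simp
  from *[OF this] show "(f has_vector_derivative d) (at (x - a))" by simp
qed

text \<open>No differentiability is assumed: \<open>vector_derivative\<close> selects a value
  satisfying a predicate, and translation leaves that predicate unchanged.\<close>

lemma Dx_shift: "(Dx ^^ n) (\<lambda>x. f (x - a)) = (\<lambda>x. (Dx ^^ n) f (x - a))"
  by (induction n) (simp_all add: Dx_def vector_derivative_def has_vector_derivative_shift)

text \<open>Bootstrapping through the equation: with a constant family and weight 1 the order
  carries no information, and closure of the algebra under differentiation is exactly
  smoothness.\<close>

lemma profile_smooth:
  fixes g :: "real \<Rightarrow> complex" and v K :: real
  assumes "\<And>x. (g has_vector_derivative \<i> * ((of_real v + g x * cnj (g x)) * g x + of_real K)) (at x)"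
  shows "((Dx ^^ m) g has_vector_derivative (Dx ^^ Suc m) g x) (at x)"
proof -
  let ?h = "\<lambda>n::nat. g" and ?w = "\<lambda>n::nat. 1::real"
  have c: "graded_alg ?w ?h j (\<lambda>n x. a)" for a j
    by (rule graded_alg.const[of _ "cmod a"]) simp
  \<comment> \<open>Orders add under products, while the vector field must have order exactly 1. The
    factors of \<open>g x * cnj (g x)\<close> are therefore weakened to order 0 first.\<close>
  have "graded_alg ?w ?h (Suc 0) (\<lambda>n x. g x)" using graded_alg.self[of ?w ?h] by simp
  then have s: "graded_alg ?w ?h 0 (\<lambda>n x. g x)" by (rule graded_alg.weaken)
  have "graded_alg ?w ?h (Suc 0) (\<lambda>n x. cnj (g x))" using graded_alg.cnj_self[of ?w ?h] by simp
  then have s': "graded_alg ?w ?h 0 (\<lambda>n x. cnj (g x))" by (rule graded_alg.weaken)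
  have "graded_alg ?w ?h (0 + ((0 + 1))) (\<lambda>n x. \<i> * ((of_real v + g x * cnj (g x)) * g x + of_real K))"
    by (intro graded_alg.mult graded_alg.add graded_alg.mult[OF s s', simplified] graded_alg.self c)
  then have d: "graded_alg ?w ?h 1 (\<lambda>n x. \<i> * ((of_real v + g x * cnj (g x)) * g x + of_real K))" by simp
  from graded_alg_Dx(2)[OF graded_alg.self d] assms show ?thesis by blast
qed

text \<open>Here \<open>c\<close> is the conjugate of \<open>g\<close>; \<open>A\<close>, \<open>A2\<close>, \<open>A3\<close> are the iterates of \<open>- \<i> d/dx\<close> on \<open>g\<close>, and
\<open>Ac\<close>, \<open>A2c\<close> those on \<open>c\<close>. The left-hand side is the nonlinearity divided by \<open>\<i>\<close>.\<close>

lemma Nl_identity: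
  fixes g c v K E A A2 A3 Ac A2c :: complex
  assumes E: "E = v * (g * c) / 2 + (g * c)^2 / 4 + K * (g + c) / 2"
    and "A = (v + g * c) * g + K" "Ac = - ((v + g * c) * c + K)"
    and "A2 = (v + 2 * g * c) * A + g^2 * Ac"
    and "A2c = - ((v + 2 * g * c) * Ac + c^2 * A)"
    and "A3 = (v + 2 * g * c) * A2 + 2 * (A * c + g * Ac) * A + 2 * g * A * Ac + g^2 * A2c"
  shows "g^2 * A2c + 4 * (g * c) * A2 + 2 * A * Ac * g + 3 * A^2 * c
           - (15/2) * (g * c)^2 * A + (5/2) * (g * c)^3 * g
         = A3 - (v^3 - 6 * v * E - K^2) * g - (v^2 * K - 2 * K * E)"
  unfolding assms by (simp add: field_simps power2_eq_square power3_eq_cube)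

text \<open>\<open>Nl_identity\<close> is the once-integrated form of this claim: it gives
  \<open>Nl g\<close> as minus the third derivative, minus \<open>\<i> * V * g\<close>, up to the
  constant \<open>- \<i> * Q\<close>, which the outer derivative removes. The term with
  \<open>V\<close> is what \<open>\<i>\<close> times the time derivative of
  \<open>g (x - V * t)\<close> produces.\<close>

lemma profile_equation:
  fixes g :: "real \<Rightarrow> complex" and v K E V :: real
  assumes g': "\<And>x. (g has_vector_derivative \<i> * ((of_real v + g x * cnj (g x)) * g x + of_real K)) (at x)"
    and E: "\<And>x. of_real E = of_real v * (g x * cnj (g x)) / 2 + (g x * cnj (g x))^2 / 4
                   + of_real K * (g x + cnj (g x)) / 2"
    and V: "V = v^3 - 6 * v * E - K^2"
  shows "Dx (Nl g) x = - \<i> * of_real V * Dx g x - (Dx ^^ 4) g x"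
proof -
  define A where "A x = (of_real v + g x * cnj (g x)) * g x + of_real K" for x
  define Ac where "Ac x = - ((of_real v + g x * cnj (g x)) * cnj (g x) + of_real K)" for x
  define A2 where "A2 x = (of_real v + 2 * g x * cnj (g x)) * A x + (g x)^2 * Ac x" for x
  define A2c where "A2c x = - ((of_real v + 2 * g x * cnj (g x)) * Ac x + (cnj (g x))^2 * A x)" for x
  define A3 where "A3 x = (of_real v + 2 * g x * cnj (g x)) * A2 x
      + 2 * (A x * cnj (g x) + g x * Ac x) * A x + 2 * g x * A x * Ac x + (g x)^2 * A2c x" for x
  have Ac: "cnj (A x) = - Ac x" for x by (simp add: A_def Ac_def algebra_simps)
  have Ac': "cnj (Ac x) = - A x" for x by (simp add: A_def Ac_def algebra_simps)
  have A2c: "cnj (A2 x) = A2c x" for x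
    by (simp add: A2_def A2c_def Ac Ac' algebra_simps)
  have d0: "(g has_vector_derivative \<i> * A x) (at x)" for x using g' by (simp add: A_def)
  have d0c: "((\<lambda>x. cnj (g x)) has_vector_derivative \<i> * Ac x) (at x)" for x
    using has_vector_derivative_cnj[OF d0[of x]] by (simp add: Ac)
  have dA: "(A has_vector_derivative \<i> * A2 x) (at x)" for x
    unfolding A_def[abs_def]
    by (rule derivative_eq_intros d0 d0c refl)+
      (simp add: A2_def A_def Ac_def algebra_simps power2_eq_square)
  have dAc: "(Ac has_vector_derivative \<i> * A2c x) (at x)" for x
    using has_vector_derivative_minus[OF has_vector_derivative_cnj[OF dA[of x]]]
    by (simp add: Ac A2c)
  have dA2: "(A2 has_vector_derivative \<i> * A3 x) (at x)" for x
    unfolding A2_def[abs_def] power2_eq_square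
    by (rule derivative_eq_intros d0 d0c dA dAc refl)+
      (simp add: A3_def algebra_simps power2_eq_square)
  have D1: "Dx g = (\<lambda>x. \<i> * A x)" using Dx_eq[OF d0] by blast
  have "((\<lambda>x. \<i> * A x) has_vector_derivative - A2 x) (at x)" for x
    using has_vector_derivative_mult_right[OF dA[of x], of \<i>] by (simp flip: mult.assoc)
  then have D2: "Dx (\<lambda>x. \<i> * A x) = (\<lambda>x. - A2 x)" using Dx_eq by blast
  have "((\<lambda>x. - A2 x) has_vector_derivative - \<i> * A3 x) (at x)" for x
    using has_vector_derivative_minus[OF dA2[of x]] by simp
  then have D3: "Dx (\<lambda>x. - A2 x) = (\<lambda>x. - \<i> * A3 x)" using Dx_eq by blast
  have DD3: "(Dx ^^ 3) g = (\<lambda>x. - \<i> * A3 x)"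
    by (simp add: numeral_3_eq_3 D1 D2 D3)
  define Q :: real where "Q = v^2 * K - 2 * K * E"
  have sq: "of_real ((cmod z)\<^sup>2) = z * cnj z" for z by (rule complex_norm_square)
  have sq4: "of_real ((cmod z)^4) = (z * cnj z)^2" for z
    by (simp flip: complex_norm_square add: power_mult[symmetric] of_real_power)
  have sq6: "of_real ((cmod z)^6) = (z * cnj z)^3" for z
    by (simp flip: complex_norm_square add: power_mult[symmetric] of_real_power)
  have N: "Nl g x = (Dx ^^ 3) g x * (-1) - \<i> * of_real V * g x - \<i> * of_real Q" for x
  proof -
    have "Nl g x = \<i> * ((g x)^2 * A2c x + 4 * (g x * cnj (g x)) * A2 x + 2 * A x * Ac x * g x
        + 3 * (A x)^2 * cnj (g x) - (15/2) * (g x * cnj (g x))^2 * A x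
        + (5/2) * (g x * cnj (g x))^3 * g x)"
      unfolding Nl_def D1 D2 sq sq4 sq6
      by (simp add: A2c Ac algebra_simps power_mult_distrib)
    also have "\<dots> = \<i> * (A3 x - of_real V * g x - of_real Q)"
      by (subst Nl_identity[OF E[of x] A_def Ac_def A2_def A2c_def A3_def])
        (simp add: V Q_def)
    finally show ?thesis unfolding DD3 by (simp add: algebra_simps)
  qed
  have "((\<lambda>x. (Dx ^^ 3) g x * (-1) - \<i> * of_real V * g x - \<i> * of_real Q) has_vector_derivative
      ((Dx ^^ Suc 3) g x * (-1) - \<i> * of_real V * (\<i> * A x) - 0)) (at x)"
    using profile_smooth[OF g', of 3 x]
    by (intro has_vector_derivative_diff has_vector_derivative_mult_left
        has_vector_derivative_mult_right d0 has_vector_derivative_const)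
  then have "Dx (\<lambda>x. (Dx ^^ 3) g x * (-1) - \<i> * of_real V * g x - \<i> * of_real Q) x
      = - (Dx ^^ 4) g x - \<i> * of_real V * Dx g x"
    by (subst Dx_eq, assumption) (simp add: D1 eval_nat_numeral)
  moreover have "Nl g = (\<lambda>x. (Dx ^^ 3) g x * (-1) - \<i> * of_real V * g x - \<i> * of_real Q)"
    using N by blast
  ultimately show ?thesis by simp
qed

lemma travelling_wave_sol:
  fixes g :: "real \<Rightarrow> complex" and v K E V :: real
  assumes g': "\<And>x. (g has_vector_derivative \<i> * ((of_real v + g x * cnj (g x)) * g x + of_real K)) (at x)"
    and E: "\<And>x. of_real E = of_real v * (g x * cnj (g x)) / 2 + (g x * cnj (g x))^2 / 4
                   + of_real K * (g x + cnj (g x)) / 2"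
    and V: "V = v^3 - 6 * v * E - K^2"
    and per: "\<And>x. g (x + 2 * pi) = g x"
  shows "classical_sol T (\<lambda>t x. g (x - V * t))"
  unfolding classical_sol_def
proof (intro conjI ballI allI)
  fix t x :: real
  show "g (x + 2 * pi - V * t) = g (x - V * t)"
    using per[of "x - V * t"] by (simp add: algebra_simps)
next
  fix t x :: real and n
  show "((Dx ^^ n) (\<lambda>x. g (x - V * t)) has_vector_derivative
            (Dx ^^ Suc n) (\<lambda>x. g (x - V * t)) x) (at x)"
    unfolding Dx_shift has_vector_derivative_shift by (rule profile_smooth[OF g'])
next
  fix n
  have "continuous_on UNIV ((Dx ^^ n) g)"
    using profile_smooth[OF g', of n] has_vector_derivative_continuous
    by (metis continuous_at_imp_continuous_on)
  then show "continuous_on ({-T<..<T} \<times> UNIV) (\<lambda>(t, x). (Dx ^^ n) (\<lambda>x. g (x - V * t)) x)"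
    unfolding Dx_shift case_prod_unfold
    by (rule continuous_on_compose2) (auto intro!: continuous_intros)
next
  fix t x :: real
  have 1: "((\<lambda>\<tau>. x - V * \<tau>) has_vector_derivative - V) (at t)"
    by (auto intro!: derivative_eq_intros)
  have "(g has_vector_derivative Dx g (x - V * t)) (at (x - V * t))"
    using profile_smooth[OF g', of 0] by simp
  from vector_diff_chain_at[OF 1 this]
  have "((\<lambda>\<tau>. g (x - V * \<tau>)) has_vector_derivative (- V) *\<^sub>R Dx g (x - V * t)) (at t)"
    by (simp add: o_def)
  moreover have "\<i> * ((- V) *\<^sub>R Dx g (x - V * t)) - (Dx ^^ 4) (\<lambda>x. g (x - V * t)) x
      = Dx (Nl (\<lambda>x. g (x - V * t))) x"
  proof -
    have "Nl (\<lambda>x. g (x - V * t)) = (\<lambda>x. Nl g (x - V * t))"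
      using Dx_shift[of 1 g] Dx_shift[of 2 g] by (auto simp: Nl_def numeral_2_eq_2)
    then show ?thesis
      using Dx_shift[of 1 "Nl g"] Dx_shift[of 4 g]
      by (simp add: profile_equation[OF g' E V] scaleR_conv_of_real)
  qed
  ultimately show "\<exists>ut. ((\<lambda>\<tau>. g (x - V * \<tau>)) has_vector_derivative ut) (at t) \<and>
      \<i> * ut - (Dx ^^ 4) (\<lambda>x. g (x - V * t)) x = Dx (Nl (\<lambda>x. g (x - V * t))) x"
    by blast
qed

section \<open>Periodic orbits near a constant\<close>

text \<open>The equation for \<open>\<psi>\<close> is separable: \<open>\<psi>\<close> is the
  inverse of an antiderivative \<open>F\<close> of \<open>1 / w\<close>, and \<open>F\<close> gains
  the same integral over every interval of length \<open>2 * pi\<close>. One full turn thus takes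
  that integral, which is the quantity to be tuned afterwards.\<close>

lemma periodic_phase:
  fixes w :: "real \<Rightarrow> real"
  assumes cont: "continuous_on UNIV w" and pos: "\<And>y. 0 < w y" and per: "\<And>y. w (y + 2 * pi) = w y"
  obtains \<psi> where "\<And>x. (\<psi> has_real_derivative w (\<psi> x)) (at x)"
    and "\<And>x. \<psi> (x + integral {0..2 * pi} (\<lambda>y. 1 / w y)) = \<psi> x + 2 * pi" and "\<psi> 0 = 0"
proof -
  let ?L = "integral {0..2 * pi} (\<lambda>y. 1 / w y)"
  have isc: "isCont (\<lambda>y. 1 / w y) y" for y
    using cont pos[of y] by (auto intro!: continuous_intros simp: continuous_on_eq_continuous_at)
  have "\<exists>F. \<forall>x. - \<infinity> < ereal x \<longrightarrow> ereal x < \<infinity> \<longrightarrow> (F has_vector_derivative 1 / w x) (at x)"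
    by (rule einterval_antiderivative) (use isc in auto)
  then obtain F0 where F0: "\<And>y. (F0 has_real_derivative 1 / w y) (at y)"
    by (auto simp: has_real_derivative_iff_has_vector_derivative)
  define F where "F y = F0 y - F0 0" for y
  have F: "(F has_real_derivative 1 / w y) (at y)" for y
    unfolding F_def[abs_def] using DERIV_diff[OF F0[of y] DERIV_const[of "F0 0"]] by simp
  have FTC: "F (2 * pi) - F 0 = ?L"
  proof -
    have "((\<lambda>y. 1 / w y) has_integral F (2 * pi) - F 0) {0..2 * pi}"
      by (rule fundamental_theorem_of_calculus)
        (use F in \<open>auto simp flip: has_real_derivative_iff_has_vector_derivative
            intro: has_field_derivative_at_within\<close>)
    then show ?thesis by (simp add: integral_unique)
  qed
  have Fper: "F (y + 2 * pi) = F y + ?L" for y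
  proof -
    have "((\<lambda>y. F (y + 2 * pi) - F y) has_real_derivative 0) (at y)" for y
    proof -
      have "((\<lambda>y. F (y + 2 * pi)) has_real_derivative 1 / w (y + 2 * pi)) (at y)"
        using F[of "y + 2 * pi"] by (simp add: DERIV_shift)
      from DERIV_diff[OF this F[of y]] show ?thesis by (simp add: per)
    qed
    from DERIV_isconst_all[OF allI[OF this], of y 0] show ?thesis using FTC by simp
  qed
  have Finc: "F x < F y" if "x < y" for x y
    by (rule DERIV_pos_imp_increasing[OF that]) (use F pos in \<open>auto intro!: exI\<close>)
  have L: "0 < ?L" using FTC Finc[of 0 "2 * pi"] by simp
  have Fn: "F (y + 2 * pi * real n) = F y + ?L * real n" for y n
  proof (induction n)
    case (Suc n)
    then show ?case using Fper[of "y + 2 * pi * real n"] by (simp add: algebra_simps)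
  qed simp
  have Fcont: "continuous_on S F" for S
    using F by (meson DERIV_isCont continuous_at_imp_continuous_on)
  have surj: "\<exists>y. F y = x" for x
  proof -
    obtain n where n: "\<bar>x - F 0\<bar> < real n * ?L" using reals_Archimedean3[OF L] by blast
    have "F (- 2 * pi * real n) \<le> x" "x \<le> F (2 * pi * real n)"
      using n Fn[of 0 n] Fn[of "- 2 * pi * real n" n] by (simp_all add: algebra_simps abs_less_iff)
    moreover have "- 2 * pi * real n \<le> 2 * pi * real n" by simp
    ultimately show ?thesis using IVT'[of F _ x _ ] Fcont by blast
  qed
  define \<psi> where "\<psi> = (\<lambda>x. SOME y. F y = x)"
  have F\<psi>: "F (\<psi> x) = x" for x unfolding \<psi>_def using someI_ex[OF surj[of x]] .
  have inj: "F x = F y \<Longrightarrow> x = y" for x y using Finc by (metis linorder_neqE_linordered_idom less_irrefl)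
  have \<psi>F: "\<psi> (F y) = y" for y using F\<psi> inj by blast
  show ?thesis
  proof (rule that)
    fix x
    have iF: "isCont F z" for z using F DERIV_isCont by blast
    have "isCont \<psi> (F (\<psi> x))"
      by (rule isCont_inverse_function[where f=F and x="\<psi> x" and d=1]) (use \<psi>F iF in auto)
    then have "(\<psi> has_real_derivative inverse (1 / w (\<psi> x))) (at x)"
      by (intro DERIV_inverse_function[OF F, of _ _ "x - 1" "x + 1"])
        (use pos[of "\<psi> x"] F\<psi> in auto)
    then show "(\<psi> has_real_derivative w (\<psi> x)) (at x)" by simp
    show "\<psi> (x + ?L) = \<psi> x + 2 * pi"
      using Fper[of "\<psi> x"] \<psi>F by (metis F\<psi>)
    show "\<psi> 0 = 0" using \<psi>F[of 0] by (simp add: F_def)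
  qed
qed

lemma periodic_nat_mult:
  assumes "\<And>x. f (x + a) = (f x :: real) + c"
  shows "f (x + real n * a) = f x + real n * c"
proof (induction n)
  case (Suc n)
  then show ?case using assms[of "x + real n * a"] by (simp add: algebra_simps)
qed simp

lemma cos_sin_add_2pi_nat: "cos (x + real n * (2 * pi)) = cos x" "sin (x + real n * (2 * pi)) = sin x"
  by (induction n) (simp_all add: algebra_simps sin_add cos_add)

text \<open>The orbit through \<open>p - d\<close> and \<open>p + d\<close>: the energy relation on the real axis is a quartic with
roots \<open>p - d\<close>, \<open>p + d\<close> and vanishing cubic term, which leaves the free parameter \<open>\<tau>\<close>. Then
\<open>\<rho> = |g|\<^sup>2\<close> satisfies \<open>4 \<rho>'\<^sup>2 = (\<rho> - (p - d)\<^sup>2) ((p + d)\<^sup>2 - \<rho>) ((\<rho> + \<tau>)\<^sup>2 - 4 p\<^sup>2 \<rho>)\<close>, which is solved by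
\<open>\<rho> = p\<^sup>2 + d\<^sup>2 - 2 p d cos \<psi>\<close>; \<open>\<tau>\<close> is chosen by the intermediate value theorem so that the
period is \<open>2 \<pi> / N\<close>.\<close>

lemma wave_exists:
  fixes N :: nat and p d :: real
  assumes N: "1 \<le> N" and d: "0 < d" "d < p" and p: "p \<le> 1 / 10"
  obtains g v K E \<tau> where
    "\<And>x. (g has_vector_derivative \<i> * ((of_real v + g x * cnj (g x)) * g x + of_real K)) (at x)"
    "\<And>x. of_real E = of_real v * (g x * cnj (g x)) / 2 + (g x * cnj (g x))^2 / 4
                   + of_real K * (g x + cnj (g x)) / 2"
    "\<And>x. g (x + 2 * pi) = g x" "\<And>x. cmod (g x - of_real p) \<le> 6 * d"
    "cmod (g 0 - of_real p) = d"
    "v = (\<tau> - 3 * p^2 - d^2) / 2" "K = p * (p^2 - d^2 - \<tau>) / 2" "E = - (p^2 - d^2) * \<tau> / 4"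
    "sqrt (4 * (real N)^2 + 4 * p^2 * (p - d)^2) - (p + d)^2 \<le> \<tau>"
    "\<tau> \<le> sqrt (4 * (real N)^2 + 4 * p^2 * (p + d)^2) - (p - d)^2"
proof -
  define b where "b = (p - d)^2"
  define D where "D = (p + d)^2"
  define rho where "rho y = p^2 + d^2 - 2 * p * d * cos y" for y
  define Q where "Q \<tau> y = (rho y + \<tau>)^2 - 4 * p^2 * rho y" for \<tau> y
  \<comment> \<open>Tuned to the crude bounds \<open>b \<le> rho y \<le> D\<close>: both
    \<open>(D + lo)^2 - 4 * p^2 * b\<close> and \<open>(b + hi)^2 - 4 * p^2 * D\<close> equal
    \<open>4 * N^2\<close>. Hence \<open>Q lo\<close> lies below and \<open>Q hi\<close> above
    \<open>(2 * N)^2\<close> at every angle, and the two periods bracket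
    \<open>2 * pi / N\<close>.\<close>
  define lo where "lo = sqrt (4 * (real N)^2 + 4 * p^2 * b) - D"
  define hi where "hi = sqrt (4 * (real N)^2 + 4 * p^2 * D) - b"
  have pd: "0 < p * d" "p > 0" using d by auto
  have pp: "p^2 \<le> 1 / 100" using power_mono[OF p, of 2] pd by (simp add: power2_eq_square)
  have dd: "d^2 < p^2" using d by (simp add: power_strict_mono)
  have b0: "0 \<le> b" by (simp add: b_def)
  have bD: "b \<le> D" "D - b = 4 * (p * d)" using pd by (simp_all add: b_def D_def power2_eq_square algebra_simps)
  have D4: "D \<le> 4 / 100"
  proof -
    have "D \<le> (2 * p)^2" unfolding D_def using d by (intro power_mono) auto
    then show ?thesis using pp by (simp add: power_mult_distrib)
  qed
  have rho: "b \<le> rho y" "rho y \<le> D" for y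
  proof -
    have "p * d * cos y \<le> p * d * 1" "p * d * (-1) \<le> p * d * cos y"
      using pd by (intro mult_left_mono; simp)+
    then show "b \<le> rho y" "rho y \<le> D" by (simp_all add: b_def D_def rho_def power2_eq_square algebra_simps)
  qed
  have lo1: "1 \<le> lo"
  proof -
    have "2 * real N = sqrt (4 * (real N)^2)" by (simp add: real_sqrt_mult)
    also have "\<dots> \<le> sqrt (4 * (real N)^2 + 4 * p^2 * b)" using b0 by (intro real_sqrt_le_mono) simp
    finally show ?thesis using D4 N by (simp add: lo_def)
  qed
  have lohi: "lo \<le> hi"
  proof -
    have "sqrt (4 * (real N)^2 + 4 * p^2 * b) \<le> sqrt (4 * (real N)^2 + 4 * p^2 * D)"
      using bD by (intro real_sqrt_le_mono add_left_mono mult_left_mono) auto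
    then show ?thesis unfolding lo_def hi_def using bD(1) by linarith
  qed
  have Qpos: "0 < Q \<tau> y" if "1 \<le> \<tau>" for \<tau> y
  proof -
    have "1^2 \<le> (rho y + \<tau>)^2" using rho(1)[of y] b0 that by (intro power_mono) auto
    moreover have "p^2 * rho y \<le> (1/100) * (4/100)"
      using pp rho[of y] b0 D4 by (intro mult_mono) auto
    ultimately show ?thesis by (simp add: Q_def)
  qed
  have sq: "(sqrt (4 * (real N)^2 + 4 * p^2 * e))^2 = 4 * (real N)^2 + 4 * p^2 * e" if "0 \<le> e" for e
    using that by simp
  have Qlo: "Q lo y \<le> (2 * real N)^2" for y
  proof -
    have "(rho y + lo)^2 \<le> (D + lo)^2" using rho[of y] b0 lo1 by (intro power_mono) auto
    moreover have "(D + lo)^2 = 4 * (real N)^2 + 4 * p^2 * b" using sq[OF b0] by (simp add: lo_def)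
    moreover have "p^2 * b \<le> p^2 * rho y" using rho[of y] by (intro mult_left_mono) auto
    ultimately show ?thesis by (simp add: Q_def power_mult_distrib)
  qed
  have Qhi: "(2 * real N)^2 \<le> Q hi y" for y
  proof -
    have "(b + hi)^2 \<le> (rho y + hi)^2" using rho[of y] b0 lo1 lohi by (intro power_mono) auto
    moreover have "(b + hi)^2 = 4 * (real N)^2 + 4 * p^2 * D" using sq[of D] b0 bD by (simp add: hi_def)
    moreover have "p^2 * rho y \<le> p^2 * D" using rho[of y] by (intro mult_left_mono) auto
    ultimately show ?thesis by (simp add: Q_def power_mult_distrib)
  qed
  \<comment> \<open>The angular speed:
    \<open>(rho - b) * (D - rho) = (2 * p * d * sin \<psi>)^2\<close> cancels against the sine in
    the derivative of \<open>rho\<close> and leaves \<open>\<psi>'^2 = Q / 4\<close>.\<close>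
  define w where "w \<tau> y = sqrt (Q \<tau> y) / 2" for \<tau> y
  define L where "L \<tau> = integral {0..2 * pi} (\<lambda>y. 1 / w \<tau> y)" for \<tau>
  have wpos: "0 < w \<tau> y" if "1 \<le> \<tau>" for \<tau> y using Qpos[OF that] by (simp add: w_def)
  have wcont: "continuous_on S (w \<tau>)" for S \<tau>
    unfolding w_def[abs_def] Q_def rho_def by (intro continuous_intros) auto
  have wint: "(\<lambda>y. 1 / w \<tau> y) integrable_on {0..2 * pi}" if "1 \<le> \<tau>" for \<tau>
    by (rule integrable_continuous_real) (use wpos[OF that] wcont in
        \<open>auto intro!: continuous_intros simp: less_imp_neq[symmetric]\<close>)
  have Lcont: "continuous_on {lo..hi} L"
  proof -
    have "continuous_on ({lo..hi} \<times> cbox 0 (2 * pi)) (\<lambda>(\<tau>, y). 1 / w \<tau> y)"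
      unfolding case_prod_unfold w_def Q_def rho_def
    proof (intro continuous_intros ballI)
      fix z assume "z \<in> {lo..hi} \<times> cbox 0 (2 * pi)"
      then have "1 \<le> fst z" using lo1 by auto
      from Qpos[OF this, of "snd z"]
      show "sqrt ((p\<^sup>2 + d\<^sup>2 - 2 * p * d * cos (snd z) + fst z)\<^sup>2
          - 4 * p\<^sup>2 * (p\<^sup>2 + d\<^sup>2 - 2 * p * d * cos (snd z))) / 2 \<noteq> 0"
        by (simp add: Q_def rho_def)
    qed auto
    from integral_continuous_on_param[OF this] show ?thesis by (simp add: L_def[abs_def])
  qed
  have N0: "0 < real N" using N by simp
  have cint: "integral {0..2 * pi} (\<lambda>y. 1 / real N) = 2 * pi / real N" by simp
  have Llo: "2 * pi / real N \<le> L lo"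
    unfolding L_def cint[symmetric]
  proof (rule integral_le)
    fix y
    have "w lo y \<le> real N" using real_le_lsqrt[OF _ Qlo[of y]] by (simp add: w_def)
    then show "1 / real N \<le> 1 / w lo y" using wpos[OF lo1, of y] by (simp add: frac_le)
  qed (use wint[OF lo1] in auto)
  have Lhi: "L hi \<le> 2 * pi / real N"
    unfolding L_def cint[symmetric]
  proof (rule integral_le)
    fix y
    have "real N \<le> w hi y" using real_le_rsqrt[OF Qhi[of y]] by (simp add: w_def)
    then show "1 / w hi y \<le> 1 / real N" using N0 by (simp add: frac_le)
  qed (use wint[of hi] lo1 lohi in auto)
  obtain \<tau> where \<tau>: "lo \<le> \<tau>" "\<tau> \<le> hi" "L \<tau> = 2 * pi / real N"
    using IVT2'[OF Lhi Llo lohi Lcont] by blast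
  have \<tau>1: "1 \<le> \<tau>" using \<tau> lo1 by simp
  have wper: "w \<tau> (y + 2 * pi) = w \<tau> y" for y by (simp add: w_def Q_def rho_def)
  obtain \<psi> where \<psi>': "\<And>x. (\<psi> has_real_derivative w \<tau> (\<psi> x)) (at x)"
    and \<psi>p: "\<And>x. \<psi> (x + 2 * pi / real N) = \<psi> x + 2 * pi" and \<psi>0: "\<psi> 0 = 0"
    using periodic_phase[OF wcont wpos[OF \<tau>1] wper] \<tau>(3) unfolding L_def by metis
  have \<psi>2: "\<psi> (x + 2 * pi) = \<psi> x + real N * (2 * pi)" for x
    using periodic_nat_mult[of \<psi> "2 * pi / real N", OF \<psi>p, of x N] N0 by simp
  \<comment> \<open>Coefficients read off from the factored energy relation on the real axis,
    \<open>x^4 / 4 + v * x^2 / 2 + K * x - E = (x^2 - 2 * p * x + p^2 - d^2) * (x^2 + 2 * p * x +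
    \<tau>) / 4\<close>.\<close>
  define v where "v = (\<tau> - 3 * p^2 - d^2) / 2"
  define K where "K = p * (p^2 - d^2 - \<tau>) / 2"
  define E where "E = - (p^2 - d^2) * \<tau> / 4"
  have K: "p * (\<tau> - 1 / 100) / 2 \<le> - K"
  proof -
    have "p * (\<tau> - 1 / 100) \<le> p * (\<tau> - p^2 + d^2)"
      using pd pp zero_le_power2[of d] by (intro mult_left_mono) linarith+
    moreover have "- K = p * (\<tau> - p^2 + d^2) / 2" by (simp add: K_def field_simps)
    ultimately show ?thesis by simp
  qed
  have K0: "K < 0"
  proof -
    have "0 < p * (\<tau> - 1 / 100) / 2" using pd \<tau>1 by simp
    then show ?thesis using K by linarith
  qed
  define R where "R x = rho (\<psi> x)" for x
  define W where "W x = w \<tau> (\<psi> x)" for x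
  \<comment> \<open>The orbit is rebuilt from its squared modulus \<open>R\<close>. The conserved
    energy is linear in the real part, which determines \<open>U\<close> because \<open>K\<close> is
    not 0; the equation for \<open>g\<close> forces \<open>R' = 2 * K * Im g\<close>, which
    determines \<open>Y\<close>.\<close>
  define U where "U x = (E - v * R x / 2 - (R x)^2 / 4) / K" for x
  have UK: "U x * K = E - v * R x / 2 - (R x)^2 / 4" for x using K0 by (simp add: U_def)
  define Y where "Y x = p * d * sin (\<psi> x) * W x / K" for x
  have W0: "0 < W x" for x using wpos[OF \<tau>1] by (simp add: W_def)
  have W2: "(W x)^2 = ((R x + \<tau>)^2 - 4 * p^2 * R x) / 4" for x
    using Qpos[OF \<tau>1, of "\<psi> x"] by (simp add: W_def w_def power_divide Q_def R_def)
  have S2: "(p * d * sin (\<psi> x))^2 = (p * d)^2 - ((p^2 + d^2 - R x) / 2)^2" for x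
    by (simp add: R_def rho_def power_mult_distrib sin_squared_eq algebra_simps)
  have C2: "p * d * cos (\<psi> x) = (p^2 + d^2 - R x) / 2" for x by (simp add: R_def rho_def)
  have dR: "(R has_real_derivative 2 * p * d * sin (\<psi> x) * W x) (at x)" for x
    unfolding R_def[abs_def] rho_def W_def
    by (auto intro!: derivative_eq_intros \<psi>')
  have dU: "(U has_real_derivative - (v + R x) * Y x) (at x)" for x
  proof -
    have "((\<lambda>x. E - v * R x / 2 - (R x)^2 / 4) has_real_derivative
        - (v + R x) * (p * d * sin (\<psi> x) * W x)) (at x)"
      by (auto intro!: derivative_eq_intros dR simp: algebra_simps)
    from DERIV_cdivide[OF this, of K] show ?thesis by (simp add: U_def[abs_def] Y_def)
  qed
  have dW: "(W has_real_derivative (2 * (R x + \<tau>) - 4 * p^2) * (p * d * sin (\<psi> x)) / 4) (at x)" for x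
  proof -
    let ?q = "(R x + \<tau>)^2 - 4 * p^2 * R x"
    have Weq: "W = (\<lambda>x. sqrt ((R x + \<tau>)^2 - 4 * p^2 * R x) / 2)"
      by (auto simp: W_def w_def Q_def R_def)
    have q: "0 < ?q" using Qpos[OF \<tau>1, of "\<psi> x"] by (simp add: Q_def R_def)
    have sW: "sqrt ?q = 2 * W x" unfolding Weq by simp
    have "((\<lambda>x. (R x + \<tau>)^2 - 4 * p^2 * R x) has_real_derivative
        (2 * (R x + \<tau>) - 4 * p^2) * (2 * p * d * sin (\<psi> x) * W x)) (at x)"
      by (rule derivative_eq_intros dR refl)+ (simp add: algebra_simps)
    from DERIV_cdivide[OF DERIV_chain2[OF DERIV_real_sqrt[OF q] this], of 2]
    have "((\<lambda>x. sqrt ((R x + \<tau>)^2 - 4 * p^2 * R x) / 2) has_real_derivative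
        (inverse (sqrt ?q) / 2) * ((2 * (R x + \<tau>) - 4 * p^2) * (2 * p * d * sin (\<psi> x) * W x)) / 2) (at x)" .
    moreover have "(inverse (sqrt ?q) / 2) * ((2 * (R x + \<tau>) - 4 * p^2) * (2 * p * d * sin (\<psi> x) * W x)) / 2
        = (2 * (R x + \<tau>) - 4 * p^2) * (p * d * sin (\<psi> x)) / 4"
      unfolding sW using W0[of x] by (simp add: divide_simps)
    ultimately show ?thesis unfolding Weq[symmetric] by (simp only:)
  qed
  have dY: "(Y has_real_derivative K + (v + R x) * U x) (at x)" for x
  proof -
    have "((\<lambda>x. p * d * sin (\<psi> x) * W x / K) has_real_derivative
      (p * d * (cos (\<psi> x) * W x) * W x + (2 * (R x + \<tau>) - 4 * p^2) * (p * d * sin (\<psi> x)) / 4 * (p * d * sin (\<psi> x))) / K) (at x)"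
      by (rule derivative_eq_intros dW \<psi>' refl)+ (use K0 in \<open>simp_all add: W_def\<close>)
    moreover have "p * d * (cos (\<psi> x) * W x) * W x + (2 * (R x + \<tau>) - 4 * p^2) * (p * d * sin (\<psi> x)) / 4 * (p * d * sin (\<psi> x))
        = p * d * cos (\<psi> x) * (W x)^2 + (2 * (R x + \<tau>) - 4 * p^2) / 4 * (p * d * sin (\<psi> x))^2"
      by (simp add: power2_eq_square algebra_simps)
    moreover have "\<dots> = K^2 + (v + R x) * (E - v * R x / 2 - (R x)^2 / 4)"
      unfolding W2 S2 C2 v_def K_def E_def by (simp add: field_simps power2_eq_square)
    moreover have "\<dots> / K = K + (v + R x) * U x"
      using K0 by (simp add: U_def field_simps power2_eq_square)
    ultimately show ?thesis unfolding Y_def[abs_def] by simp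
  qed
  \<comment> \<open>Consistency of the two recipes. Multiplied by \<open>K^2\<close> it becomes a
    polynomial identity in \<open>R\<close>, and it encodes that the energy quartic has been
    factored correctly.\<close>
  have mod2: "(U x)^2 + (Y x)^2 = R x" for x
  proof -
    have "K^2 * ((U x)^2 + (Y x)^2) = (K * U x)^2 + (K * Y x)^2" by (simp add: power_mult_distrib algebra_simps)
    also have "\<dots> = (E - v * R x / 2 - (R x)^2 / 4)^2 + (p * d * sin (\<psi> x))^2 * (W x)^2"
      using K0 by (simp add: U_def Y_def power_mult_distrib)
    also have "\<dots> = K^2 * R x"
      unfolding W2 S2 v_def K_def E_def by (simp add: field_simps power2_eq_square)
    finally show ?thesis using K0 by simp
  qed
  define g where "g x = of_real (U x) + \<i> * of_real (Y x)" for x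
  have gg: "g x * cnj (g x) = of_real (R x)" for x
    unfolding g_def mod2[of x, symmetric] by (simp add: algebra_simps power2_eq_square)
  have Rb: "b \<le> R x" "R x \<le> D" for x using rho by (simp_all add: R_def)
  have Yb: "\<bar>Y x\<bar> \<le> 2 * d" for x
  proof -
    have "sqrt (Q \<tau> (\<psi> x)) \<le> R x + \<tau>"
    proof (rule real_le_lsqrt)
      have "0 \<le> p\<^sup>2 * rho (\<psi> x)" using rho(1)[of "\<psi> x"] b0 by simp
      then show "Q \<tau> (\<psi> x) \<le> (R x + \<tau>)\<^sup>2" by (simp add: Q_def R_def mult.commute)
    qed (use Rb[of x] b0 \<tau>1 in simp)
    then have "W x \<le> (R x + \<tau>) / 2" by (simp add: W_def w_def)
    then have "W x \<le> \<tau> - 1 / 100" using Rb[of x] D4 \<tau>1 by simp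
    then have "p * W x \<le> p * (\<tau> - 1 / 100)" using pd by (intro mult_left_mono) auto
    then have "p * W x \<le> 2 * - K" using K by simp
    then have "d * (p * W x) \<le> d * (2 * - K)" using d by (intro mult_left_mono) auto
    moreover have "\<bar>p * d * sin (\<psi> x) * W x\<bar> \<le> d * (p * W x)"
    proof -
      have "\<bar>sin (\<psi> x)\<bar> * (p * d * W x) \<le> 1 * (p * d * W x)"
        using pd W0[of x] by (intro mult_right_mono) auto
      then show ?thesis using pd d W0[of x] by (simp add: abs_mult ac_simps)
    qed
    ultimately have "\<bar>p * d * sin (\<psi> x) * W x\<bar> \<le> 2 * d * \<bar>K\<bar>" using K0 by simp
    then show ?thesis unfolding Y_def abs_divide by (subst pos_divide_le_eq) (use K0 in auto)
  qed
  have Ub: "\<bar>U x - (p - d)\<bar> \<le> 3 * d" for x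
  proof -
    \<comment> \<open>At \<open>R = b\<close> the energy relation yields \<open>U = p - d\<close>,
      since \<open>p - d\<close> is a root of the quartic. Hence \<open>R x - b\<close> splits off,
      and \<open>R x - b \<le> 4 * p * d\<close> supplies the factor \<open>d\<close>.\<close>
    have e: "(U x - (p - d)) * (- K) = (R x - b) * (v / 2 + (R x + b) / 4)"
    proof -
      have "(U x - (p - d)) * K = E - v * R x / 2 - (R x)^2 / 4 - (p - d) * K"
        by (simp only: left_diff_distrib UK)
      also have "\<dots> = - ((R x - b) * (v / 2 + (R x + b) / 4))"
        unfolding E_def v_def K_def b_def by (simp add: field_simps power2_eq_square)
      finally show ?thesis by simp
    qed
    have v: "0 \<le> v / 2 + (R x + b) / 4" "v / 2 + (R x + b) / 4 \<le> \<tau> / 4 + 2 / 100"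
    proof -
      have e: "v / 2 + (R x + b) / 4 = (2 * v + R x + b) / 4" by simp
      have v2: "2 * v = \<tau> - 3 * p^2 - d^2" by (simp add: v_def)
      have "0 \<le> 2 * v + R x + b" unfolding v2 using pp dd \<tau>1 Rb[of x] b0 by linarith
      moreover have "2 * v + R x + b \<le> \<tau> + 8 / 100"
        unfolding v2 using Rb[of x] D4 bD(1) zero_le_power2[of p] zero_le_power2[of d] by linarith
      ultimately show "0 \<le> v / 2 + (R x + b) / 4" "v / 2 + (R x + b) / 4 \<le> \<tau> / 4 + 2 / 100"
        unfolding e by simp_all
    qed
    have "(R x - b) * (v / 2 + (R x + b) / 4) \<le> (4 * (p * d)) * (\<tau> / 4 + 2 / 100)"
      using v Rb[of x] bD pd \<tau>1 by (intro mult_mono) auto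
    also have "\<dots> = (p * d) * (\<tau> + 8 / 100)" by (simp add: field_simps)
    also have "\<dots> \<le> (p * d) * (3 / 2 * (\<tau> - 1 / 100))" using pd \<tau>1 by (intro mult_left_mono) auto
    also have "\<dots> = 3 * d * (p * (\<tau> - 1 / 100) / 2)" by simp
    also have "\<dots> \<le> 3 * d * (- K)" using K d by (intro mult_left_mono) auto
    finally have "(U x - (p - d)) * (- K) \<le> 3 * d * (- K)" using e by simp
    then have "U x - (p - d) \<le> 3 * d" using K0 by (simp only: mult_le_cancel_right)
    moreover have "0 \<le> (U x - (p - d)) * (- K)" unfolding e using v Rb[of x] by simp
    then have "0 \<le> U x - (p - d)" using K0 by (simp add: zero_le_mult_iff mult_le_0_iff)
    ultimately show ?thesis by simp
  qed
  have gb: "cmod (g x - of_real p) \<le> 6 * d" for x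
  proof -
    have "g x - of_real p = of_real (U x - p) + \<i> * of_real (Y x)" by (simp add: g_def)
    then have "cmod (g x - of_real p) \<le> \<bar>U x - p\<bar> + \<bar>Y x\<bar>"
      by (metis norm_triangle_ineq norm_mult norm_ii mult_1 norm_of_real)
    then show ?thesis using Ub[of x] Yb[of x] d by linarith
  qed
  \<comment> \<open>Phase 0 is the turning point \<open>p - d\<close>, so the displacement there is
    exactly \<open>d\<close>. This value later bounds mode \<open>N\<close> from below.\<close>
  have R0: "R 0 = b" by (simp add: R_def rho_def \<psi>0 b_def power2_eq_square algebra_simps)
  have "U 0 * K = E - v * b / 2 - b^2 / 4" by (simp only: UK R0)
  also have "\<dots> = (p - d) * K"
    unfolding E_def v_def K_def b_def by (simp add: field_simps power2_eq_square)
  finally have "U 0 = p - d" using K0 by simp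
  then have g0: "cmod (g 0 - of_real p) = d" using d by (simp add: g_def Y_def \<psi>0)
  show ?thesis
  proof (rule that[of g v K E \<tau>])
    fix x
    have "(g has_vector_derivative of_real (- (v + R x) * Y x) + \<i> * of_real (K + (v + R x) * U x)) (at x)"
      unfolding g_def[abs_def]
      by (intro has_vector_derivative_add has_vector_derivative_mult_right has_vector_derivative_of_real
          has_real_derivative_iff_has_vector_derivative[THEN iffD1] dU dY)
    moreover have "of_real (- (v + R x) * Y x) + \<i> * of_real (K + (v + R x) * U x)
        = \<i> * ((of_real v + g x * cnj (g x)) * g x + of_real K)"
      unfolding gg by (simp add: g_def algebra_simps)
    ultimately show "(g has_vector_derivative \<i> * ((of_real v + g x * cnj (g x)) * g x + of_real K)) (at x)" by simp
    have "g x + cnj (g x) = of_real (2 * U x)" by (simp add: g_def)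
    then have "of_real v * (g x * cnj (g x)) / 2 + (g x * cnj (g x))^2 / 4 + of_real K * (g x + cnj (g x)) / 2
        = (of_real (v * R x / 2 + (R x)^2 / 4 + K * U x) :: complex)"
      unfolding gg by simp
    also have "v * R x / 2 + (R x)^2 / 4 + K * U x = E" using UK[of x] by (simp add: mult.commute)
    finally show "of_real E = of_real v * (g x * cnj (g x)) / 2 + (g x * cnj (g x))^2 / 4
                   + of_real K * (g x + cnj (g x)) / 2" by simp
    show "g (x + 2 * pi) = g x"
      unfolding g_def U_def Y_def W_def R_def w_def Q_def rho_def \<psi>2 cos_sin_add_2pi_nat ..
    show "cmod (g x - of_real p) \<le> 6 * d" by (rule gb)
    show "cmod (g 0 - of_real p) = d" by (rule g0)
  qed (use \<tau> in \<open>simp_all add: v_def K_def E_def lo_def hi_def b_def D_def\<close>)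
qed

section \<open>Fourier coefficients\<close>

lemma fourier_integrable:
  assumes "continuous_on UNIV f"
  shows "(\<lambda>x. exp (- \<i> * of_int k * of_real x) * f x) integrable_on {0..2*pi}"
  by (rule integrable_continuous_real)
    (use assms in \<open>auto intro!: continuous_intros intro: continuous_on_subset\<close>)

lemma fourier_coeff_add:
  assumes "continuous_on UNIV f" "continuous_on UNIV g"
  shows "fourier_coeff (\<lambda>x. f x + g x) k = fourier_coeff f k + fourier_coeff g k"
  using integral_add[OF fourier_integrable[OF assms(1), of k] fourier_integrable[OF assms(2), of k]]
  by (simp add: fourier_coeff_def distrib_left add_divide_distrib)

lemma fourier_coeff_cmult:
  shows "fourier_coeff (\<lambda>x. c * f x) k = c * fourier_coeff f k"
  unfolding fourier_coeff_def by (simp add: mult.left_commute)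

lemma fourier_coeff_bound:
  assumes f: "continuous_on UNIV f" and M: "\<And>x. cmod (f x) \<le> M"
  shows "cmod (fourier_coeff f k) \<le> M"
proof -
  have "cmod (integral {0..2*pi} (\<lambda>x. exp (- \<i> * of_int k * of_real x) * f x)) \<le> M * (2 * pi - 0)"
    by (rule integral_bound)
      (use M f in \<open>auto intro!: continuous_intros intro: continuous_on_subset simp: norm_mult norm_exp_eq_Re\<close>)
  then show ?thesis by (simp add: fourier_coeff_def norm_divide field_simps)
qed

lemma fourier_coeff_cnj: "fourier_coeff (\<lambda>x. cnj (f x)) k = cnj (fourier_coeff f (- k))"
  unfolding fourier_coeff_def by (simp add: integral_cnj exp_cnj)

lemma exp_periodic_int: "exp (- \<i> * of_int k * of_real (x + 2 * pi)) = exp (- \<i> * of_int k * of_real x)"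
proof -
  have "exp (- \<i> * of_int k * of_real (x + 2 * pi))
      = exp (- \<i> * of_int k * of_real x) * exp ((2 * of_int (- k) * pi) * \<i>)"
    by (simp add: algebra_simps flip: exp_add)
  also have "exp ((2 * of_int (- k) * pi) * \<i>) = 1"
    using exp_integer_2pi[of "of_int (- k)"] by (simp add: mult_ac)
  finally show ?thesis by simp
qed

lemma fourier_coeff_deriv:
  assumes f': "\<And>x. (f has_vector_derivative f' x) (at x)" and c: "continuous_on UNIV f'"
    and per: "\<And>x. f (x + 2 * pi) = f x"
  shows "fourier_coeff f' k = \<i> * of_int k * fourier_coeff f k"
proof -
  let ?e = "\<lambda>x::real. exp (- \<i> * of_int k * of_real x)"
  have cf: "continuous_on UNIV f"
    using f' has_vector_derivative_continuous by (metis continuous_at_imp_continuous_on)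
  have "((\<lambda>x. ?e x * f x) has_vector_derivative ?e x * f' x + (- \<i> * of_int k * ?e x) * f x) (at x)" for x
  proof -
    have "((\<lambda>z. exp (- \<i> * of_int k * z)) has_field_derivative - \<i> * of_int k * ?e x) (at (of_real x))"
      by (auto intro!: derivative_eq_intros)
    from has_vector_derivative_real_field[OF this] f' show ?thesis
      by (intro has_vector_derivative_mult) auto
  qed
  then have "((\<lambda>x. ?e x * f' x + (- \<i> * of_int k * ?e x) * f x) has_integral
      ?e (2 * pi) * f (2 * pi) - ?e 0 * f 0) {0..2 * pi}"
    by (intro fundamental_theorem_of_calculus) (auto intro: has_vector_derivative_at_within)
  moreover have "?e (2 * pi) * f (2 * pi) - ?e 0 * f 0 = 0"
    using exp_periodic_int[of k 0] per[of 0] by simp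
  ultimately have "integral {0..2 * pi} (\<lambda>x. ?e x * f' x + (- \<i> * of_int k) * (?e x * f x)) = 0"
    by (simp add: integral_unique mult.assoc)
  moreover have "integral {0..2 * pi} (\<lambda>x. ?e x * f' x + (- \<i> * of_int k) * (?e x * f x))
      = integral {0..2 * pi} (\<lambda>x. ?e x * f' x) + (- \<i> * of_int k) * integral {0..2 * pi} (\<lambda>x. ?e x * f x)"
    by (intro integral_unique has_integral_add has_integral_mult_right integrable_integral
        fourier_integrable c cf)
  ultimately show ?thesis
    unfolding fourier_coeff_def by (simp add: field_simps)
qed

text \<open>For an antiderivative \<open>F\<close>, periodicity makes \<open>F (x + P) - F x\<close>
  constant in \<open>x\<close>, and both integrals are values of this difference.\<close>

lemma periodic_integral_shift:
  fixes f :: "real \<Rightarrow> complex"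
  assumes c: "continuous_on UNIV f" and per: "\<And>x. f (x + P) = f x" and P: "0 \<le> P"
  shows "integral {0..P} (\<lambda>x. f (x - a)) = integral {0..P} f"
proof -
  have "\<exists>F. \<forall>x. - \<infinity> < ereal x \<longrightarrow> ereal x < \<infinity> \<longrightarrow> (F has_vector_derivative f x) (at x)"
    by (rule einterval_antiderivative) (use c in \<open>auto simp: continuous_on_eq_continuous_at\<close>)
  then obtain F where F: "\<And>y. (F has_vector_derivative f y) (at y)" by auto
  have Fa: "((\<lambda>x. F (x - a)) has_vector_derivative f (x - a)) (at x)" for x a
    unfolding has_vector_derivative_shift by (rule F)
  have "((\<lambda>x. F (x - (- P)) - F x) has_vector_derivative 0) (at x)" for x
    using has_vector_derivative_diff[OF Fa[of "- P" x] F[of x]] per[of x] by simp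
  then obtain C where C: "\<And>x. F (x + P) - F x = C"
    using has_vector_derivative_zero_constant[of UNIV "\<lambda>x. F (x - (- P)) - F x"] by auto
  have I: "integral {0..P} (\<lambda>x. f (x - a)) = F (P - a) - F (0 - a)" for a
    by (rule integral_unique, rule fundamental_theorem_of_calculus[OF P])
      (use Fa in \<open>auto intro: has_vector_derivative_at_within\<close>)
  show ?thesis using I[of a] I[of 0] C[of "- a"] C[of 0] by (simp add: algebra_simps)
qed

lemma fourier_coeff_shift:
  assumes c: "continuous_on UNIV f" and per: "\<And>x. f (x + 2 * pi) = f x"
  shows "fourier_coeff (\<lambda>x. f (x - a)) k = exp (- \<i> * of_int k * of_real a) * fourier_coeff f k"
proof -
  let ?F = "\<lambda>x. exp (- \<i> * of_int k * of_real x) * f x"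
  have "exp (- \<i> * of_int k * of_real x) * f (x - a) = exp (- \<i> * of_int k * of_real a) * ?F (x - a)" for x
    by (simp add: algebra_simps flip: exp_add)
  then have "integral {0..2 * pi} (\<lambda>x. exp (- \<i> * of_int k * of_real x) * f (x - a))
      = integral {0..2 * pi} (\<lambda>x. exp (- \<i> * of_int k * of_real a) * ?F (x - a))"
    by (intro integral_cong)
  also have "\<dots> = exp (- \<i> * of_int k * of_real a) * integral {0..2 * pi} (\<lambda>x. ?F (x - a))"
    by (rule integral_mult_right)
  also have "integral {0..2 * pi} (\<lambda>x. ?F (x - a)) = integral {0..2 * pi} ?F"
  proof (rule periodic_integral_shift)
    show "continuous_on UNIV ?F" by (intro continuous_intros c)
    show "?F (x + 2 * pi) = ?F x" for x by (simp only: per exp_periodic_int)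
  qed simp
  finally show ?thesis by (simp add: fourier_coeff_def)
qed

lemma fourier_coeff_plane_wave:
  "fourier_coeff (\<lambda>x. a * exp (\<i> * of_int m * of_real x)) = sgl m a"
proof
  fix k
  let ?f = "\<lambda>x::real. a * exp (\<i> * of_int m * of_real x)"
  have f': "(?f has_vector_derivative (\<i> * of_int m) * ?f x) (at x)" for x
  proof -
    have "((\<lambda>z. a * exp (\<i> * of_int m * z)) has_field_derivative (\<i> * of_int m) * ?f x) (at (of_real x))"
      by (auto intro!: derivative_eq_intros)
    from has_vector_derivative_real_field[OF this] show ?thesis .
  qed
  have per: "?f (x + 2 * pi) = ?f x" for x
    using exp_periodic_int[of "- m" x] by simp
  \<comment> \<open>Two expressions for the coefficient of the derivative: \<open>m\<close> and
    \<open>k\<close> act as eigenvalues, so the coefficient vanishes for \<open>k \<noteq> m\<close>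
    without evaluating an integral.\<close>
  have "\<i> * of_int m * fourier_coeff ?f k = \<i> * of_int k * fourier_coeff ?f k"
    unfolding fourier_coeff_cmult[symmetric]
    by (rule fourier_coeff_deriv[OF f' _ per, unfolded fourier_coeff_cmult[symmetric]]) (auto intro!: continuous_intros)
  then have "k \<noteq> m \<Longrightarrow> fourier_coeff ?f k = 0" by auto
  moreover have "fourier_coeff ?f m = a"
  proof -
    have "exp (- \<i> * of_int m * of_real x) * ?f x = a" for x
      by (simp add: exp_minus)
    then have "integral {0..2*pi} (\<lambda>x. exp (- \<i> * of_int m * of_real x) * ?f x) = integral {0..2*pi} (\<lambda>x. a)"
      by (intro integral_cong)
    then show ?thesis by (simp add: fourier_coeff_def scaleR_conv_of_real)
  qed
  ultimately show "fourier_coeff ?f k = sgl m a k" by (auto simp: sgl_def)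
qed

text \<open>Each of \<open>m \<ge> - q\<close> integrations by parts gains a factor
  \<open>1 / k\<close>, while the \<open>m\<close>-th derivative still has order \<open>j\<close>.
  So arbitrary decay in \<open>k\<close> is available together with the full power
  \<open>w n ^ j\<close>, uniformly in \<open>n\<close>.\<close>

lemma graded_alg_fourier_decay:
  assumes f: "graded_alg w h j f"
    and h': "graded_alg w h 1 h'" "\<And>n x. (h n has_vector_derivative h' n x) (at x)"
    and w: "\<And>n. 0 \<le> w n" "\<And>n. w n \<le> 1"
    and h: "\<And>n x. cmod (h n x) \<le> B * w n" and per: "\<And>n x. h n (x + 2 * pi) = h n x"
  shows "\<exists>M\<ge>0. \<forall>n k. cmod (fourier_coeff (f n) k) \<le> M * w n ^ j * jbr k powr q"
proof -
  have fper: "f n (x + 2 * pi) = f n x" if "graded_alg w h j f" for f j n x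
    using that by induction (simp_all add: per)
  let ?D = "\<lambda>m n. (Dx ^^ m) (f n)"
  have A: "graded_alg w h j (?D m)" for m by (rule graded_alg_Dx(1)[OF f h'])
  have d: "(?D m n has_vector_derivative ?D (Suc m) n x) (at x)" for m n x
    by (rule graded_alg_Dx(2)[OF f h'])
  have c: "continuous_on UNIV (?D m n)" for m n
    using d has_vector_derivative_continuous by (metis continuous_at_imp_continuous_on)
  have F: "fourier_coeff (?D m n) k = (\<i> * of_int k) ^ m * fourier_coeff (f n) k" for m n k
  proof (induction m)
    case (Suc m)
    have "fourier_coeff (?D (Suc m) n) k = \<i> * of_int k * fourier_coeff (?D m n) k"
      by (rule fourier_coeff_deriv[OF d c]) (rule fper[OF A])
    then show ?case by (simp add: Suc)
  qed simp
  obtain m :: nat where m: "- q \<le> real m" using real_arch_simple by blast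
  obtain M0 where M0: "0 \<le> M0" "\<And>n x. cmod (f n x) \<le> M0 * w n ^ j"
    using graded_alg_bound[OF f w h] by blast
  obtain M1 where M1: "0 \<le> M1" "\<And>n x. cmod (?D m n x) \<le> M1 * w n ^ j"
    using graded_alg_bound[OF A w h] by blast
  have "cmod (fourier_coeff (f n) k) \<le> (2 ^ m * (M0 + M1)) * w n ^ j * jbr k powr q" for n k
  proof -
    let ?a = "cmod (fourier_coeff (f n) k)" and ?k = "\<bar>real_of_int k\<bar>"
    have 0: "?a \<le> M0 * w n ^ j"
      using fourier_coeff_bound[OF c[of 0 n]] M0(2) by simp
    have 1: "?k ^ m * ?a \<le> M1 * w n ^ j"
      using fourier_coeff_bound[OF c[of m n] M1(2), of k] by (simp add: F norm_mult norm_power)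
    have j: "jbr k ^ m \<le> 2 ^ m * (1 + ?k ^ m)"
    proof -
      have "jbr k \<le> 1 + ?k"
        unfolding jbr_def by (rule real_le_lsqrt) (auto simp: power2_eq_square algebra_simps)
      also have "\<dots> \<le> 2 * max 1 ?k" by simp
      finally have "jbr k ^ m \<le> (2 * max 1 ?k) ^ m" using jbr_pos[of k] by (intro power_mono) auto
      also have "\<dots> = 2 ^ m * max 1 ?k ^ m" by (simp add: power_mult_distrib)
      also have "max 1 ?k ^ m \<le> 1 + ?k ^ m" by (simp add: max_def)
      finally show ?thesis by simp
    qed
    have "jbr k ^ m * ?a \<le> 2 ^ m * (1 + ?k ^ m) * ?a" using j by (intro mult_right_mono) auto
    also have "\<dots> = 2 ^ m * ((1 + ?k ^ m) * ?a)" by simp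
    also have "(1 + ?k ^ m) * ?a \<le> (M0 + M1) * w n ^ j" using 0 1 by (simp add: algebra_simps)
    finally have "jbr k ^ m * ?a \<le> 2 ^ m * ((M0 + M1) * w n ^ j)" by simp
    then have "?a \<le> 2 ^ m * ((M0 + M1) * w n ^ j) / jbr k ^ m"
      using jbr_pos[of k] by (simp add: field_simps)
    also have "\<dots> = 2 ^ m * (M0 + M1) * w n ^ j * jbr k powr (- real m)"
      using jbr_pos[of k] by (simp add: powr_minus powr_realpow divide_inverse)
    also have "\<dots> \<le> 2 ^ m * (M0 + M1) * w n ^ j * jbr k powr q"
      using M0(1) M1(1) w m jbr_ge1[of k] by (intro mult_left_mono powr_mono) auto
    finally show ?thesis .
  qed
  then show ?thesis using M0(1) M1(1) by (intro exI[of _ "2 ^ m * (M0 + M1)"]) auto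
qed

section \<open>The flow on plane waves\<close>

lemma flow_wave:
  fixes g :: "real \<Rightarrow> complex" and v K E V :: real
  assumes S: "is_flow_map s r T S" and t: "t \<in> {-T<..<T}"
    and g': "\<And>x. (g has_vector_derivative \<i> * ((of_real v + g x * cnj (g x)) * g x + of_real K)) (at x)"
    and E: "\<And>x. of_real E = of_real v * (g x * cnj (g x)) / 2 + (g x * cnj (g x))^2 / 4
                   + of_real K * (g x + cnj (g x)) / 2"
    and V: "V = v^3 - 6 * v * E - K^2"
    and per: "\<And>x. g (x + 2 * pi) = g x"
  shows "S (fourier_coeff g) t = (\<lambda>k. exp (- \<i> * of_int k * of_real (V * t)) * fourier_coeff g k)"
proof -
  have c: "continuous_on UNIV g"
    using g' has_vector_derivative_continuous by (metis continuous_at_imp_continuous_on)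
  have "classical_sol T (\<lambda>t x. g (x - V * t))"
    by (rule travelling_wave_sol[OF g' E V per])
  then have "S (fourier_coeff (\<lambda>x. g (x - V * 0))) t = fourier_coeff (\<lambda>x. g (x - V * t))"
    using S t unfolding is_flow_map_def by blast
  then show ?thesis by (simp add: fourier_coeff_shift[OF c per, abs_def])
qed

text \<open>A plane wave of mode \<open>k\<close> is a circular orbit of the profile equation with
  \<open>K = 0\<close>, for which \<open>v + (cmod a)^2 = k\<close>. The bracket is its energy, and
  the value is the speed \<open>v^3 - 6 * v * E\<close>.\<close>

definition pw_speed :: "int \<Rightarrow> complex \<Rightarrow> real" where
  "pw_speed k a = (let v = of_int k - (cmod a)^2
     in v^3 - 6 * v * (v * (cmod a)^2 / 2 + (cmod a)^4 / 4))"

lemma flow_plane_wave: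
  assumes S: "is_flow_map s r T S" and t: "t \<in> {-T<..<T}"
  shows "S (sgl k a) t = sgl k (exp (- \<i> * of_int k * of_real (pw_speed k a * t)) * a)"
proof -
  define v where "v = of_int k - (cmod a)^2"
  define E where "E = v * (cmod a)^2 / 2 + (cmod a)^4 / 4"
  let ?g = "\<lambda>x::real. a * exp (\<i> * of_int k * of_real x)"
  have gg: "?g x * cnj (?g x) = of_real ((cmod a)^2)" for x
    by (simp only: complex_norm_square[symmetric] norm_mult norm_exp_eq_Re) simp
  have "S (fourier_coeff ?g) t = (\<lambda>j. exp (- \<i> * of_int j * of_real (pw_speed k a * t)) * fourier_coeff ?g j)"
  proof (rule flow_wave[OF S t, where v=v and K=0 and E=E])
    fix x
    have "((\<lambda>z. a * exp (\<i> * of_int k * z)) has_field_derivative (\<i> * of_int k) * ?g x) (at (of_real x))"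
      by (auto intro!: derivative_eq_intros)
    from has_vector_derivative_real_field[OF this]
    show "(?g has_vector_derivative \<i> * ((of_real v + ?g x * cnj (?g x)) * ?g x + of_real 0)) (at x)"
      unfolding gg by (simp add: v_def mult.assoc)
    show "of_real E = of_real v * (?g x * cnj (?g x)) / 2 + (?g x * cnj (?g x))\<^sup>2 / 4
        + of_real 0 * (?g x + cnj (?g x)) / 2"
      unfolding gg by (simp add: E_def power_mult[symmetric])
    show "?g (x + 2 * pi) = ?g x" using exp_periodic_int[of "- k" x] by simp
  qed (simp add: pw_speed_def v_def E_def Let_def)
  then show ?thesis by (auto simp: fourier_coeff_plane_wave sgl_def)
qed

text \<open>By homogeneity \<open>L\<close> is the limit of difference quotients along shrinking
  plane waves, whose evolution is explicit. Their speed tends to \<open>k ^ 3\<close> with the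
  amplitude, so \<open>L\<close> acts on each mode as the free evolution and does not mix
  modes.\<close>

lemma flow_derivative_at_0:
  assumes r: "1 \<le> r" and S: "is_flow_map s r T S" and t: "t \<in> {-T<..<T}"
    and L: "bounded_lin1 s r L"
    and frechet: "\<And>e. 0 < e \<Longrightarrow> \<exists>d>0. \<forall>h\<in>Hhat s r. hnorm s r h < d \<longrightarrow>
        (\<forall>k. wt s (\<lambda>k. S h t k - S (\<lambda>_. 0) t k - L h k) k \<le> e * hnorm s r h)"
  shows "L (sgl k a) m = (if m = k then exp (- \<i> * of_int k * of_real (of_int k ^ 3 * t)) * a else 0)"
proof -
  define c where "c n = 1 / real (Suc n)" for n
  define f where "f n = (if m = k then exp (- \<i> * of_int k * of_real (pw_speed k (c n *\<^sub>R a) * t)) * a else 0)" for n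
  have c0: "c \<longlonglongrightarrow> 0" unfolding c_def[abs_def] by real_asymp
  have cp: "0 < c n" for n by (simp add: c_def)
  have sg: "sgl k (c n *\<^sub>R a) = (\<lambda>j. c n *\<^sub>R sgl k a j)" for n by (auto simp: sgl_def)
  have S0: "S (\<lambda>_. 0) t = (\<lambda>_. 0)" using flow_plane_wave[OF S t, of 0 0] by simp
  have Sf: "S (sgl k (c n *\<^sub>R a)) t m = c n *\<^sub>R f n" for n
    unfolding flow_plane_wave[OF S t] by (simp add: sgl_def f_def)
  have Lf: "L (sgl k (c n *\<^sub>R a)) m = c n *\<^sub>R L (sgl k a) m" for n
    unfolding sg bounded_lin1D(3)[OF L sgl_Hhat(1)[OF r]] ..
  have hn: "hnorm s r (sgl k (c n *\<^sub>R a)) = c n * (jbr k powr s * cmod a)" for n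
    using cp[of n] by (simp add: sgl_Hhat(2)[OF r])
  define J where "J = jbr m powr s"
  have J: "0 < J" using jbr_pos[of m] by (simp add: J_def)
  define A where "A = jbr k powr s * cmod a"
  have A: "0 \<le> A" by (simp add: A_def)
  have "f \<longlonglongrightarrow> L (sgl k a) m"
  proof (rule LIMSEQ_I)
    fix e :: real assume e: "0 < e"
    define e' where "e' = e * J / (2 * (A + 1))"
    have e': "0 < e'" using e J A by (simp add: e'_def)
    from frechet[OF this] obtain d where d: "0 < d" and dd: "\<And>h. h \<in> Hhat s r \<Longrightarrow> hnorm s r h < d \<Longrightarrow>
        wt s (\<lambda>k. S h t k - S (\<lambda>_. 0) t k - L h k) m \<le> e' * hnorm s r h" by blast
    have "(\<lambda>n. c n * A) \<longlonglongrightarrow> 0" using tendsto_mult_left_zero[OF c0] .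
    from order_tendstoD(2)[OF this d] obtain n0 where n0: "\<And>n. n0 \<le> n \<Longrightarrow> c n * A < d"
      by (auto simp: eventually_sequentially)
    show "\<exists>n0. \<forall>n\<ge>n0. norm (f n - L (sgl k a) m) < e"
    proof (intro exI[of _ n0] allI impI)
      fix n assume "n0 \<le> n"
      with dd[OF sgl_Hhat(1)[OF r], of k "c n *\<^sub>R a"] n0
      have "J * cmod (c n *\<^sub>R f n - c n *\<^sub>R L (sgl k a) m) \<le> e' * (c n * A)"
        by (simp add: wt_def S0 Sf Lf hn A_def J_def)
      also have "c n *\<^sub>R f n - c n *\<^sub>R L (sgl k a) m = c n *\<^sub>R (f n - L (sgl k a) m)"
        by (simp add: scaleR_diff_right)
      finally have "c n * (J * cmod (f n - L (sgl k a) m)) \<le> c n * (e' * A)"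
        using cp[of n] by (simp add: ac_simps)
      then have "J * cmod (f n - L (sgl k a) m) \<le> e' * A"
        using cp[of n] by (simp only: mult_le_cancel_left_pos)
      also have "\<dots> = J * (e * (A / (2 * (A + 1))))" by (simp add: e'_def)
      finally have "cmod (f n - L (sgl k a) m) \<le> e * (A / (2 * (A + 1)))"
        using J by (simp only: mult_le_cancel_left_pos)
      also have "\<dots> < e * 1" using e A by (intro mult_strict_left_mono) (auto simp: divide_less_eq)
      finally show "norm (f n - L (sgl k a) m) < e" by simp
    qed
  qed
  moreover have "f \<longlonglongrightarrow> (if m = k then exp (- \<i> * of_int k * of_real (of_int k ^ 3 * t)) * a else 0)"
  proof (cases "m = k")
    case True
    have ca: "(\<lambda>n. cmod (c n *\<^sub>R a)) \<longlonglongrightarrow> 0" using tendsto_mult_left_zero[OF c0, of "cmod a"] cp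
      by (simp add: abs_of_pos)
    have "(\<lambda>n. pw_speed k (c n *\<^sub>R a)) \<longlonglongrightarrow> (of_int k - 0^2)^3 - 6 * (of_int k - 0^2)
        * ((of_int k - 0^2) * 0^2 / 2 + 0^4 / 4)"
      unfolding pw_speed_def Let_def by (intro tendsto_intros ca) auto
    from tendsto_of_real[OF this]
    have "(\<lambda>n. complex_of_real (pw_speed k (c n *\<^sub>R a))) \<longlonglongrightarrow> of_int k ^ 3" by simp
    then show ?thesis using True unfolding f_def by (auto intro!: tendsto_intros)
  qed (simp add: f_def[abs_def])
  ultimately show ?thesis by (rule LIMSEQ_unique)
qed

section \<open>Asymptotics of the periodic orbits\<close>

text \<open>The speed \<open>V\<close> of the orbits around \<open>p\<close> in the limit \<open>d \<longrightarrow> 0\<close>.\<close>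

definition lim_speed :: "nat \<Rightarrow> real \<Rightarrow> real" where
  "lim_speed N p = (let \<tau> = sqrt (4 * (real N)^2 + 4 * p^4) - p^2; v = (\<tau> - 3 * p^2) / 2
     in v^3 - 6 * v * (- (p^2 * \<tau> / 4)) - (p * (p^2 - \<tau>) / 2)^2)"

text \<open>\<open>\<tau>\<close> was found by an intermediate value argument and is known only
  through its two bounds. As the amplitude vanishes these coincide, which forces convergence of
  \<open>\<tau>\<close> and with it of \<open>v\<close>, \<open>K\<close>, \<open>E\<close> and the
  speed.\<close>

lemma wave_sequence:
  fixes N :: nat and p :: real
  assumes N: "1 \<le> N" and p: "0 < p" "p \<le> 1 / 10"
  obtains g :: "nat \<Rightarrow> real \<Rightarrow> complex" and v K E V d :: "nat \<Rightarrow> real" where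
    "\<And>n x. (g n has_vector_derivative \<i> * ((of_real (v n) + g n x * cnj (g n x)) * g n x + of_real (K n))) (at x)"
    "\<And>n x. of_real (E n) = of_real (v n) * (g n x * cnj (g n x)) / 2 + (g n x * cnj (g n x))^2 / 4
                   + of_real (K n) * (g n x + cnj (g n x)) / 2"
    "\<And>n. V n = v n^3 - 6 * v n * E n - K n^2"
    "\<And>n x. g n (x + 2 * pi) = g n x" "\<And>n x. cmod (g n x - of_real p) \<le> 6 * d n"
    "\<And>n. cmod (g n 0 - of_real p) = d n" "\<And>n. 0 < d n" "\<And>n. d n < p" "d \<longlonglongrightarrow> 0"
    "\<And>n. K n = - (p * d n^2) - v n * p - p^3"
    "v \<longlonglongrightarrow> sqrt ((real N)^2 + p^4) - 2 * p^2" "V \<longlonglongrightarrow> lim_speed N p"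
proof -
  define d where "d n = p / (real n + 2)" for n
  have d0: "0 < d n" "d n < p" for n using p by (auto simp: d_def divide_less_eq)
  have dl: "d \<longlonglongrightarrow> 0" unfolding d_def[abs_def] by real_asymp
  have "\<exists>g v K E \<tau>. (\<forall>x. (g has_vector_derivative \<i> * ((of_real v + g x * cnj (g x)) * g x + of_real K)) (at x)) \<and>
      (\<forall>x. of_real E = of_real v * (g x * cnj (g x)) / 2 + (g x * cnj (g x))^2 / 4
                   + of_real K * (g x + cnj (g x)) / 2) \<and>
      (\<forall>x. g (x + 2 * pi) = g x) \<and> (\<forall>x. cmod (g x - of_real p) \<le> 6 * d n) \<and>
      cmod (g 0 - of_real p) = d n \<and>
      v = (\<tau> - 3 * p^2 - d n^2) / 2 \<and> K = p * (p^2 - d n^2 - \<tau>) / 2 \<and> E = - (p^2 - d n^2) * \<tau> / 4 \<and>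
      sqrt (4 * (real N)^2 + 4 * p^2 * (p - d n)^2) - (p + d n)^2 \<le> \<tau> \<and>
      \<tau> \<le> sqrt (4 * (real N)^2 + 4 * p^2 * (p + d n)^2) - (p - d n)^2" for n
    by (rule wave_exists[OF N d0[of n] p(2)]) blast
  then obtain g v K E \<tau> where W: "\<And>n.
      (\<forall>x. (g n has_vector_derivative \<i> * ((of_real (v n) + g n x * cnj (g n x)) * g n x + of_real (K n))) (at x)) \<and>
      (\<forall>x. of_real (E n) = of_real (v n) * (g n x * cnj (g n x)) / 2 + (g n x * cnj (g n x))^2 / 4
                   + of_real (K n) * (g n x + cnj (g n x)) / 2) \<and>
      (\<forall>x. g n (x + 2 * pi) = g n x) \<and> (\<forall>x. cmod (g n x - of_real p) \<le> 6 * d n) \<and>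
      cmod (g n 0 - of_real p) = d n \<and>
      v n = (\<tau> n - 3 * p^2 - d n^2) / 2 \<and> K n = p * (p^2 - d n^2 - \<tau> n) / 2 \<and> E n = - (p^2 - d n^2) * \<tau> n / 4 \<and>
      sqrt (4 * (real N)^2 + 4 * p^2 * (p - d n)^2) - (p + d n)^2 \<le> \<tau> n \<and>
      \<tau> n \<le> sqrt (4 * (real N)^2 + 4 * p^2 * (p + d n)^2) - (p - d n)^2"
    by metis
  define t where "t = sqrt (4 * (real N)^2 + 4 * p^4) - p^2"
  have v: "v n = (\<tau> n - 3 * p^2 - d n^2) / 2" and K: "K n = p * (p^2 - d n^2 - \<tau> n) / 2"
    and E: "E n = - (p^2 - d n^2) * \<tau> n / 4" for n using W[of n] by auto
  have \<tau>: "\<tau> \<longlonglongrightarrow> t"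
  proof (rule tendsto_sandwich)
    show "(\<lambda>n. sqrt (4 * (real N)^2 + 4 * p^2 * (p - d n)^2) - (p + d n)^2) \<longlonglongrightarrow> t"
      by (rule tendsto_eq_intros dl refl)+ (simp_all add: t_def eval_nat_numeral algebra_simps)
    show "(\<lambda>n. sqrt (4 * (real N)^2 + 4 * p^2 * (p + d n)^2) - (p - d n)^2) \<longlonglongrightarrow> t"
      by (rule tendsto_eq_intros dl refl)+ (simp_all add: t_def eval_nat_numeral algebra_simps)
  qed (use W in auto)
  have vl: "v \<longlonglongrightarrow> (t - 3 * p^2 - 0^2) / 2"
    unfolding v[abs_def] by (intro tendsto_intros \<tau> dl) auto
  have Kl: "K \<longlonglongrightarrow> p * (p^2 - 0^2 - t) / 2"
    unfolding K[abs_def] by (intro tendsto_intros \<tau> dl) auto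
  have El: "E \<longlonglongrightarrow> - (p^2 - 0^2) * t / 4"
    unfolding E[abs_def] by (intro tendsto_intros \<tau> dl) auto
  have "t = 2 * sqrt ((real N)^2 + p^4) - p^2"
  proof -
    have "4 * (real N)^2 + 4 * p^4 = 2^2 * ((real N)^2 + p^4)" by simp
    then show ?thesis unfolding t_def by (simp only: real_sqrt_mult) simp
  qed
  then have "(t - 3 * p^2 - 0^2) / 2 = sqrt ((real N)^2 + p^4) - 2 * p^2" by simp
  with vl have vl': "v \<longlonglongrightarrow> sqrt ((real N)^2 + p^4) - 2 * p^2" by (simp only:)
  show ?thesis
  proof (rule that[of g v K E "\<lambda>n. v n^3 - 6 * v n * E n - K n^2" d])
    have "(\<lambda>n. v n^3 - 6 * v n * E n - K n^2) \<longlonglongrightarrow> ((t - 3 * p^2 - 0^2) / 2)^3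
        - 6 * ((t - 3 * p^2 - 0^2) / 2) * (- (p^2 - 0^2) * t / 4) - (p * (p^2 - 0^2 - t) / 2)^2"
      by (intro tendsto_intros vl Kl El)
    also have "((t - 3 * p^2 - 0^2) / 2)^3
        - 6 * ((t - 3 * p^2 - 0^2) / 2) * (- (p^2 - 0^2) * t / 4) - (p * (p^2 - 0^2 - t) / 2)^2 = lim_speed N p"
      by (simp add: lim_speed_def Let_def t_def)
    finally show "(\<lambda>n. v n^3 - 6 * v n * E n - K n^2) \<longlonglongrightarrow> lim_speed N p" .
    \<comment> \<open>In this form \<open>K\<close> cancels the value of
      \<open>(v + |g|^2) * g\<close> at \<open>g = p\<close> up to \<open>- p * d^2\<close>, so the
      equation for \<open>g - p\<close> has a constant term of second order only.\<close>
    show "K n = - (p * d n^2) - v n * p - p^3" for n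
      unfolding v K by (simp add: field_simps power2_eq_square power3_eq_cube)
  qed (use W d0 dl vl' in auto)
qed

text \<open>Undoing the rotation: \<open>y\<close> has derivative at most \<open>B\<close> in
  modulus, so over one period it stays within \<open>2 * pi * B \<le> 7 * B\<close> of
  \<open>h 0\<close>, and the coefficient of \<open>h\<close> at \<open>N\<close> is the mean of
  \<open>y\<close>.\<close>

lemma fourier_coeff_near:
  fixes h :: "real \<Rightarrow> complex" and N :: nat
  assumes h': "\<And>x. (h has_vector_derivative h' x) (at x)"
    and B: "\<And>x. cmod (h' x - \<i> * of_nat N * h x) \<le> B"
  shows "cmod (fourier_coeff h (int N) - h 0) \<le> 7 * B"
proof -
  let ?e = "\<lambda>x::real. exp (\<i> * of_int (- int N) * of_real x)"
  define y where "y x = ?e x * h x" for x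
  have c: "continuous_on UNIV h"
    using h' has_vector_derivative_continuous by (metis continuous_at_imp_continuous_on)
  have ne: "cmod (?e x) = 1" for x by (simp add: norm_exp_eq_Re)
  have y': "(y has_vector_derivative ?e x * (h' x - \<i> * of_nat N * h x)) (at x)" for x
  proof -
    have "((\<lambda>z. exp (\<i> * of_int (- int N) * z)) has_field_derivative (\<i> * of_int (- int N)) * ?e x) (at (of_real x))"
      by (auto intro!: derivative_eq_intros)
    from has_vector_derivative_mult[OF has_vector_derivative_real_field[OF this] h']
    show ?thesis unfolding y_def[abs_def] by (simp add: algebra_simps)
  qed
  have B0: "0 \<le> B" using B[of 0] norm_ge_zero order_trans by blast
  have yb: "cmod (y x - y 0) \<le> 7 * B" if "x \<in> {0..2*pi}" for x
  proof -
    have "cmod (y x - y 0) \<le> B * cmod (of_real x - of_real 0)"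
    proof -
      have "norm (y x - y 0) \<le> B * norm (x - 0)"
      proof (rule differentiable_bound[of UNIV y "\<lambda>x t. t *\<^sub>R (?e x * (h' x - \<i> * of_nat N * h x))"])
        show "(y has_derivative (\<lambda>t. t *\<^sub>R (?e x * (h' x - \<i> * of_nat N * h x)))) (at x within UNIV)" for x
          using y'[of x] by (simp add: has_vector_derivative_def)
        show "onorm (\<lambda>t. t *\<^sub>R (?e x * (h' x - \<i> * of_nat N * h x))) \<le> B" for x
        proof (rule onorm_le)
          fix t :: real
          have "norm (t *\<^sub>R (?e x * (h' x - \<i> * of_nat N * h x))) = cmod (h' x - \<i> * of_nat N * h x) * norm t"
            unfolding norm_scaleR norm_mult ne by simp
          also have "\<dots> \<le> B * norm t" by (rule mult_right_mono[OF B]) simp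
          finally show "norm (t *\<^sub>R (?e x * (h' x - \<i> * of_nat N * h x))) \<le> B * norm t" .
        qed
      qed auto
      then show ?thesis by simp
    qed
    also have "\<dots> \<le> B * 7"
      using that B0 pi_less_4 pi_approx by (intro mult_left_mono) auto
    finally show ?thesis by simp
  qed
  have "fourier_coeff h (int N) - h 0 = integral {0..2*pi} (\<lambda>x. y x - y 0) / of_real (2 * pi)"
  proof -
    have "integral {0..2*pi} (\<lambda>x. y x - y 0) = integral {0..2*pi} y - integral {0..2*pi} (\<lambda>x. y 0)"
      by (rule integral_diff)
        (use fourier_integrable[OF c, of "int N"] in \<open>auto simp: y_def[abs_def]\<close>)
    moreover have "integral {0..2*pi} y = fourier_coeff h (int N) * of_real (2 * pi)"
      by (simp add: fourier_coeff_def y_def[abs_def])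
    moreover have "integral {0..2*pi} (\<lambda>x. y 0) = h 0 * of_real (2 * pi)"
      by (simp add: y_def scaleR_conv_of_real)
    ultimately show ?thesis by (simp add: field_simps)
  qed
  moreover have "cmod (integral {0..2*pi} (\<lambda>x. y x - y 0)) \<le> (7 * B) * (2 * pi - 0)"
  proof (rule integral_bound)
    have "continuous_on UNIV y"
      using y' has_vector_derivative_continuous by (metis continuous_at_imp_continuous_on)
    then show "continuous_on {0..2*pi} (\<lambda>x. y x - y 0)"
      by (intro continuous_intros) (auto intro: continuous_on_subset)
  qed (use yb in auto)
  ultimately show ?thesis by (simp add: norm_divide divide_le_eq)
qed

text \<open>For \<open>h = g - p\<close> the profile equation reads
  \<open>h' = \<i> * (al * h + p^2 * cnj h + Q)\<close> with \<open>Q\<close> quadratically small.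
  In Fourier variables it couples only \<open>k\<close> and \<open>- k\<close>, with divisor
  \<open>k - al\<close>. Since \<open>al\<close> ends up close to \<open>N\<close>, the divisor is
  small at \<open>k = N\<close> alone, and every other mode is controlled by its partner and by
  \<open>Q\<close>.\<close>

lemma wave_family:
  fixes N :: nat and p q :: real
  assumes N: "1 \<le> N" and p: "0 < p" "p \<le> 1 / 20"
  obtains g :: "nat \<Rightarrow> real \<Rightarrow> complex" and V d :: "nat \<Rightarrow> real" and H :: "nat \<Rightarrow> fseq" and M :: real where
    "\<And>s r T S t n. is_flow_map s r T S \<Longrightarrow> t \<in> {-T<..<T} \<Longrightarrow>
       S (fourier_coeff (g n)) t = (\<lambda>k. exp (- \<i> * of_int k * of_real (V n * t)) * fourier_coeff (g n) k)"
    "V \<longlonglongrightarrow> lim_speed N p" "\<And>n. 0 < d n" "d \<longlonglongrightarrow> 0" "0 \<le> M"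
    "\<And>n. fourier_coeff (g n) = (\<lambda>k. sgl 0 (of_real p) k + H n k)"
    "\<And>n k. cmod (H n k) \<le> M * d n * jbr k powr q"
    "\<forall>\<^sub>F n in sequentially. d n \<le> 2 * cmod (H n (int N))"
    "\<forall>\<^sub>F n in sequentially. cmod (H n (- int N)) \<le> cmod (H n (int N)) + M * d n ^ 2"
    "\<forall>\<^sub>F n in sequentially. \<forall>k. k \<noteq> int N \<longrightarrow> k \<noteq> - int N \<longrightarrow> cmod (H n k) \<le> M * d n ^ 2 * jbr k powr q"
proof -
  have p10: "p \<le> 1 / 10" using p by simp
  obtain g v K E V d where
    g': "\<And>n x. (g n has_vector_derivative \<i> * ((of_real (v n) + g n x * cnj (g n x)) * g n x + of_real (K n))) (at x)"
    and E: "\<And>n x. of_real (E n) = of_real (v n) * (g n x * cnj (g n x)) / 2 + (g n x * cnj (g n x))^2 / 4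
                   + of_real (K n) * (g n x + cnj (g n x)) / 2"
    and V: "\<And>n. V n = v n^3 - 6 * v n * E n - K n^2"
    and per: "\<And>n x. g n (x + 2 * pi) = g n x" and gb: "\<And>n x. cmod (g n x - of_real p) \<le> 6 * d n"
    and g0: "\<And>n. cmod (g n 0 - of_real p) = d n" and d: "\<And>n. 0 < d n" "\<And>n. d n < p" "d \<longlonglongrightarrow> 0"
    and K: "\<And>n. K n = - (p * d n^2) - v n * p - p^3"
    and vl: "v \<longlonglongrightarrow> sqrt ((real N)^2 + p^4) - 2 * p^2" and Vl: "V \<longlonglongrightarrow> lim_speed N p"
    by (rule wave_sequence[OF N p(1) p10]) (rule that)
  \<comment> \<open>Coefficient of \<open>h\<close> in the linearization at \<open>p\<close>, whose
    frequency is \<open>sqrt (al^2 - p^4)\<close>. The limit of \<open>al\<close> makes it exactly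
    \<open>N\<close>.\<close>
  define al where "al n = v n + 2 * p^2" for n
  have al: "al \<longlonglongrightarrow> sqrt ((real N)^2 + p^4)"
    unfolding al_def[abs_def] using tendsto_add[OF vl tendsto_const[of "2 * p^2"]] by simp
  define h where "h n x = g n x - of_real p" for n x
  define Q where "Q n x = of_real p * (h n x * h n x) + of_real (2 * p) * (h n x * cnj (h n x))
      + h n x * (h n x * cnj (h n x)) + of_real (- (p * d n^2))" for n x
  define h' where "h' n x = \<i> * (of_real (al n) * h n x + of_real (p^2) * cnj (h n x) + Q n x)" for n x
  have hd: "(h n has_vector_derivative h' n x) (at x)" for n x
  proof -
    have gh: "g n x = of_real p + h n x" by (simp add: h_def)
    have "(h n has_vector_derivative \<i> * ((of_real (v n) + g n x * cnj (g n x)) * g n x + of_real (K n))) (at x)"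
      using has_vector_derivative_diff[OF g' has_vector_derivative_const] by (simp add: h_def[abs_def])
    moreover have "(of_real (v n) + g n x * cnj (g n x)) * g n x + of_real (K n)
        = of_real (al n) * h n x + of_real (p^2) * cnj (h n x) + Q n x"
      unfolding gh Q_def al_def K by (simp add: algebra_simps power2_eq_square power3_eq_cube)
    ultimately show ?thesis by (simp add: h'_def)
  qed
  have hper: "h n (x + 2 * pi) = h n x" for n x by (simp add: h_def per)
  have hb: "cmod (h n x) \<le> 6 * d n" for n x using gb by (simp add: h_def)
  have d1: "0 \<le> d n" "d n \<le> 1" for n using d(1,2)[of n] p by (auto intro: less_imp_le)
  have cst: "graded_alg d h 0 (\<lambda>n x. of_real c)" for c by (rule graded_alg.const[of _ "\<bar>c\<bar>"]) simp
  have sf: "graded_alg d h 1 h" and cs: "graded_alg d h 1 (\<lambda>n x. cnj (h n x))" by (rule graded_alg.self graded_alg.cnj_self)+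
  have Qa: "graded_alg d h 2 Q"
  proof -
    have "graded_alg d h (0 + (1 + 1)) (\<lambda>n x. of_real p * (h n x * h n x))"
      "graded_alg d h (0 + (1 + 1)) (\<lambda>n x. of_real (2 * p) * (h n x * cnj (h n x)))"
      "graded_alg d h (1 + (1 + 1)) (\<lambda>n x. h n x * (h n x * cnj (h n x)))"
      by (intro graded_alg.mult cst sf cs)+
    note * = this
    have c: "graded_alg d h 2 (\<lambda>n x. of_real (- (p * d n^2)))"
      by (rule graded_alg.const[of _ "\<bar>p\<bar>"]) (simp only: norm_of_real, simp add: abs_mult)
    have "graded_alg d h 2 (\<lambda>n x. of_real p * (h n x * h n x))"
      "graded_alg d h 2 (\<lambda>n x. of_real (2 * p) * (h n x * cnj (h n x)))"
      "graded_alg d h 2 (\<lambda>n x. h n x * (h n x * cnj (h n x)))"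
      by (rule *[THEN graded_alg_mono]; simp)+
    from graded_alg.add[OF graded_alg.add[OF graded_alg.add[OF this(1,2)] this(3)] c]
    show ?thesis unfolding Q_def[abs_def] by simp
  qed
  have "Bseq al" by (rule convergent_imp_Bseq[OF convergentI[OF al]])
  then obtain A where A: "\<And>n. norm (al n) \<le> A" by (auto simp: Bseq_def)
  have h'a: "graded_alg d h 1 h'"
  proof -
    have "graded_alg d h 0 (\<lambda>n x. of_real (al n))" by (rule graded_alg.const[of _ A]) (use A in simp)
    then have "graded_alg d h (0 + 1) (\<lambda>n x. of_real (al n) * h n x)" by (intro graded_alg.mult sf)
    moreover have "graded_alg d h (0 + 1) (\<lambda>n x. of_real (p^2) * cnj (h n x))" by (intro graded_alg.mult cst cs)
    moreover have "graded_alg d h 1 Q" by (rule graded_alg_mono[OF Qa]) simp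
    ultimately have *: "graded_alg d h 1 (\<lambda>n x. of_real (al n) * h n x + of_real (p^2) * cnj (h n x) + Q n x)"
      by (intro graded_alg.add) simp_all
    have "graded_alg d h 0 (\<lambda>n x. \<i>)" by (rule graded_alg.const[of _ 1]) simp
    from graded_alg.mult[OF this *] show ?thesis by (simp add: h'_def[abs_def])
  qed
  obtain M1 where M1: "0 \<le> M1" "\<And>n k. cmod (fourier_coeff (h n) k) \<le> M1 * d n ^ 1 * jbr k powr q"
    using graded_alg_fourier_decay[OF sf h'a hd d1 hb hper, of q] by blast
  obtain M2 where M2: "0 \<le> M2" "\<And>n k. cmod (fourier_coeff (Q n) k) \<le> M2 * d n ^ 2 * jbr k powr q"
    using graded_alg_fourier_decay[OF Qa h'a hd d1 hb hper, of q] by blast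
  obtain M3 where M3: "0 \<le> M3" "\<And>n x. cmod (Q n x) \<le> M3 * d n ^ 2"
    using graded_alg_bound[OF Qa d1 hb] by blast
  have ch: "continuous_on UNIV (h n)" for n
    using hd has_vector_derivative_continuous by (metis continuous_at_imp_continuous_on)
  have cQ: "continuous_on UNIV (Q n)" for n
    unfolding Q_def[abs_def] by (intro continuous_intros ch)
  have ch': "continuous_on UNIV (h' n)" for n
    unfolding h'_def[abs_def] by (intro continuous_intros ch cQ)
  define H where "H n = fourier_coeff (h n)" for n
  define qh where "qh n k = fourier_coeff (Q n) k" for n k
  have rel: "of_real (of_int k - al n) * H n k = of_real (p^2) * cnj (H n (- k)) + qh n k" for n k
  proof -
    have "fourier_coeff (h' n) k = \<i> * (of_real (al n) * H n k + of_real (p^2) * cnj (H n (- k)) + qh n k)"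
      unfolding h'_def[abs_def] fourier_coeff_cmult H_def qh_def fourier_coeff_cnj[symmetric]
      by (subst fourier_coeff_add; (subst fourier_coeff_add)?; (intro continuous_intros ch cQ)?)
        (simp add: fourier_coeff_cmult)
    then have "\<i> * of_int k * H n k = \<i> * (of_real (al n) * H n k + of_real (p^2) * cnj (H n (- k)) + qh n k)"
      using fourier_coeff_deriv[OF hd ch' hper, of n k] by (simp add: H_def)
    then have "of_int k * H n k = of_real (al n) * H n k + of_real (p^2) * cnj (H n (- k)) + qh n k"
      by (simp add: mult.assoc)
    then show ?thesis by (simp add: algebra_simps)
  qed
  have rb: "\<bar>of_int k - al n\<bar> * cmod (H n k) \<le> p^2 * cmod (H n (- k)) + cmod (qh n k)" for n k
  proof -
    have "\<bar>of_int k - al n\<bar> * cmod (H n k) = cmod (of_real (of_int k - al n) * H n k)"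
      by (simp only: norm_mult norm_of_real)
    also have "\<dots> \<le> cmod (of_real (p^2) * cnj (H n (- k))) + cmod (qh n k)"
      unfolding rel by (rule norm_triangle_ineq)
    finally show ?thesis by (simp add: norm_mult norm_power)
  qed
  have pp: "p^2 \<le> 1 / 400" using power_mono[OF p(2), of 2] p by (simp add: power2_eq_square)
  have aN: "\<forall>\<^sub>F n in sequentially. \<bar>al n - real N\<bar> < 1 / 200"
  proof -
    have "sqrt ((real N)^2 + p^4) \<le> real N + 1 / 400"
    proof (rule real_le_lsqrt)
      have "p^4 \<le> (1 / 400) * (1 / 400)"
        using mult_mono[OF pp pp] by (simp flip: power_add)
      also have "\<dots> \<le> 1 / 400 * real N" using N by simp
      finally show "(real N)^2 + p^4 \<le> (real N + 1 / 400)^2"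
        using N by (simp add: power2_eq_square algebra_simps)
    qed simp
    moreover have "real N \<le> sqrt ((real N)^2 + p^4)" by (rule real_le_rsqrt) simp
    ultimately have "sqrt ((real N)^2 + p^4) < real N + 1 / 200" "real N - 1 / 200 < sqrt ((real N)^2 + p^4)"
      by simp_all
    from order_tendstoD(2)[OF al this(1)] order_tendstoD(1)[OF al this(2)]
    show ?thesis by eventually_elim linarith
  qed
  have dM: "\<forall>\<^sub>F n in sequentially. M3 * d n < 1 / 100"
    using order_tendstoD(2)[OF tendsto_mult_right_zero[OF d(3), of M3], of "1 / 100"] by simp
  have lower: "\<forall>\<^sub>F n in sequentially. d n \<le> 2 * cmod (H n (int N))"
    using aN dM
  proof eventually_elim
    case (elim n)
    \<comment> \<open>The three terms give \<open>6/200 + 6/400 + 1/100 \<le> 6/100\<close>; the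
      factor 7 of \<open>fourier_coeff_near\<close> turns this into \<open>42/100\<close>, which
      leaves mode \<open>N\<close> more than half of \<open>cmod (h n 0) = d n\<close>.\<close>
    have "cmod (h' n x - \<i> * of_nat N * h n x) \<le> 6 / 100 * d n" for x
    proof -
      have "h' n x - \<i> * of_nat N * h n x
          = \<i> * (of_real (al n - real N) * h n x + of_real (p^2) * cnj (h n x) + Q n x)"
        by (simp add: h'_def algebra_simps)
      then have "cmod (h' n x - \<i> * of_nat N * h n x)
          = cmod (of_real (al n - real N) * h n x + of_real (p^2) * cnj (h n x) + Q n x)"
        by (simp only: norm_mult norm_ii mult_1)
      also have "\<dots> \<le> cmod (of_real (al n - real N) * h n x) + cmod (of_real (p^2) * cnj (h n x)) + cmod (Q n x)"
        by (meson add_right_mono norm_triangle_ineq order_trans)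
      also have "cmod (of_real (al n - real N) * h n x) = \<bar>al n - real N\<bar> * cmod (h n x)"
        by (simp only: norm_mult norm_of_real)
      also have "\<dots> \<le> 1 / 200 * (6 * d n)"
        using elim hb[of n x] by (intro mult_mono) auto
      also have "cmod (of_real (p^2) * cnj (h n x)) = p^2 * cmod (h n x)" by (simp add: norm_mult norm_power)
      also have "\<dots> \<le> 1 / 400 * (6 * d n)"
        using pp hb[of n x] by (intro mult_mono) auto
      also have "cmod (Q n x) \<le> 1 / 100 * d n"
      proof -
        have "M3 * d n ^ 2 = (M3 * d n) * d n" by (simp add: power2_eq_square)
        also have "\<dots> \<le> 1 / 100 * d n" using elim d1[of n] by (intro mult_right_mono) auto
        finally show ?thesis using M3(2)[of n x] by simp
      qed
      finally show ?thesis using d1[of n] by simp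
    qed
    from fourier_coeff_near[OF hd this]
    have "cmod (H n (int N) - h n 0) \<le> 42 / 100 * d n" by (simp add: H_def)
    moreover have "cmod (h n 0) = d n" using g0 by (simp add: h_def)
    moreover have "cmod (h n 0) \<le> cmod (H n (int N)) + cmod (H n (int N) - h n 0)"
      by (metis norm_minus_commute norm_triangle_sub)
    ultimately show ?case using d1[of n] by simp
  qed
  define M where "M = max M1 (max (8 * M2) (M2 * jbr (- int N) powr q))"
  have M: "M1 \<le> M" "8 * M2 \<le> M" "M2 * jbr (- int N) powr q \<le> M" by (auto simp: M_def)
  have M0: "0 \<le> M" using M1 M by simp
  have qb: "cmod (qh n k) \<le> M2 * d n ^ 2 * jbr k powr q" for n k using M2 by (simp add: qh_def)
  have b1: "\<forall>\<^sub>F n in sequentially. cmod (H n (- int N)) \<le> cmod (H n (int N)) + M * d n ^ 2"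
    using aN
  proof eventually_elim
    case (elim n)
    have "1 \<le> real N" "real_of_int (- int N) = - real N" using N by simp_all
    with elim have "1 \<le> \<bar>of_int (- int N) - al n\<bar>" by linarith
    then have "1 * cmod (H n (- int N)) \<le> \<bar>of_int (- int N) - al n\<bar> * cmod (H n (- int N))"
      by (intro mult_right_mono) auto
    also have "\<dots> \<le> p^2 * cmod (H n (int N)) + cmod (qh n (- int N))" using rb[of "- int N" n] by simp
    also have "p^2 * cmod (H n (int N)) \<le> 1 * cmod (H n (int N))" using pp by (intro mult_right_mono) auto
    also have "cmod (qh n (- int N)) \<le> M * d n ^ 2"
      using qb[of n "- int N"] mult_right_mono[OF M(3), of "d n ^ 2"] by (simp add: mult_ac)
    finally show ?case by simp
  qed
  have b2: "\<forall>\<^sub>F n in sequentially. \<forall>k. k \<noteq> int N \<longrightarrow> k \<noteq> - int N \<longrightarrow> cmod (H n k) \<le> M * d n ^ 2 * jbr k powr q"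
    using aN
  proof eventually_elim
    case (elim n)
    have half: "1 / 2 * cmod (H n k) \<le> 1 / 400 * cmod (H n (- k)) + M2 * d n ^ 2 * jbr k powr q"
      if "k \<noteq> int N" for k
    proof -
      have "1 \<le> \<bar>of_int k - real N\<bar>"
      proof -
        have "1 \<le> \<bar>k - int N\<bar>" using that by simp
        then have "1 \<le> real_of_int \<bar>k - int N\<bar>" by linarith
        then show ?thesis by simp
      qed
      then have "1 / 2 \<le> \<bar>of_int k - al n\<bar>" using elim by linarith
      then have "1 / 2 * cmod (H n k) \<le> \<bar>of_int k - al n\<bar> * cmod (H n k)" by (intro mult_right_mono) auto
      also note rb[of k n]
      also have "p^2 * cmod (H n (- k)) \<le> 1 / 400 * cmod (H n (- k))" using pp by (intro mult_right_mono) auto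
      finally show ?thesis using qb[of n k] by simp
    qed
    show ?case
    proof (intro allI impI)
      fix k assume "k \<noteq> int N" "k \<noteq> - int N"
      \<comment> \<open>Neither \<open>k\<close> nor \<open>- k\<close> is resonant, so the
        inequality holds for both with the same weight. The off-diagonal factor
        \<open>1 / 400\<close> lets the pair be solved.\<close>
      then have "1 / 2 * cmod (H n k) \<le> 1 / 400 * cmod (H n (- k)) + M2 * d n ^ 2 * jbr k powr q"
        "1 / 2 * cmod (H n (- k)) \<le> 1 / 400 * cmod (H n k) + M2 * d n ^ 2 * jbr k powr q"
        using half[of k] half[of "- k"] by auto
      moreover have "0 \<le> M2 * d n ^ 2 * jbr k powr q" using M2 by simp
      ultimately have "cmod (H n k) \<le> 8 * (M2 * d n ^ 2 * jbr k powr q)" by linarith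
      also have "\<dots> = (8 * M2) * (d n ^ 2 * jbr k powr q)" by simp
      also have "\<dots> \<le> M * (d n ^ 2 * jbr k powr q)" using M by (intro mult_right_mono) auto
      finally show "cmod (H n k) \<le> M * d n ^ 2 * jbr k powr q" by (simp add: mult_ac)
    qed
  qed
  show ?thesis
  proof (rule that[of g V d M H])
    show "S (fourier_coeff (g n)) t = (\<lambda>k. exp (- \<i> * of_int k * of_real (V n * t)) * fourier_coeff (g n) k)"
      if "is_flow_map s r T S" "t \<in> {-T<..<T}" for s r T S t n
      by (rule flow_wave[OF that g' E V per])
    show "fourier_coeff (g n) = (\<lambda>k. sgl 0 (of_real p) k + H n k)" for n
    proof
      fix k
      have "g n = (\<lambda>x. of_real p * exp (\<i> * of_int 0 * of_real x) + h n x)" by (auto simp: h_def)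
      then have "fourier_coeff (g n) k = fourier_coeff (\<lambda>x. of_real p * exp (\<i> * of_int 0 * of_real x)) k
          + fourier_coeff (h n) k"
        by (simp only:) (rule fourier_coeff_add, intro continuous_intros, rule ch)
      then show "fourier_coeff (g n) k = sgl 0 (of_real p) k + H n k"
        by (simp only: fourier_coeff_plane_wave H_def)
    qed
    show "cmod (H n k) \<le> M * d n * jbr k powr q" for n k
    proof -
      have "cmod (H n k) \<le> M1 * (d n * jbr k powr q)" using M1(2)[of n k] by (simp add: H_def)
      also have "\<dots> \<le> M * (d n * jbr k powr q)" using M d1[of n] by (intro mult_right_mono) auto
      finally show ?thesis by simp
    qed
  qed (use d Vl M0 lower b1 b2 in auto)
qed

section \<open>Failure of differentiability\<close>

text \<open>Both derivatives are tested on \<open>H n\<close>. At \<open>p\<close> the exact waves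
  show the phase belonging to \<open>lim_speed\<close>, at 0 the free phase appears, and the two
  derivatives differ by at most \<open>C * p\<close> times the norm of \<open>H n\<close>. Up to
  vanishing terms this norm is at most 20 times the weighted coefficient at \<open>N\<close>, so the
  weight cancels.\<close>

lemma phase_gap_bound:
  fixes N :: nat and p :: real
  assumes r: "1 \<le> r" and S: "is_flow_map s r T S" and t: "t \<in> {-T<..<T}"
    and D1: "\<And>x. x \<in> Hhat s r \<Longrightarrow> bounded_lin1 s r (D1 x)"
    and frechet: "\<And>x e. x \<in> Hhat s r \<Longrightarrow> 0 < e \<Longrightarrow> \<exists>d>0. \<forall>h\<in>Hhat s r. hnorm s r h < d \<longrightarrow>
        (\<forall>k. wt s (\<lambda>k. S (\<lambda>j. x j + h j) t k - S x t k - D1 x h k) k \<le> e * hnorm s r h)"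
    and C: "0 \<le> C"
    and lip: "\<And>x v k. x \<in> Hhat s r \<Longrightarrow> hnorm s r x < d0 \<Longrightarrow> v \<in> Hhat s r \<Longrightarrow>
        wt s (\<lambda>k. D1 x v k - D1 (\<lambda>_. 0) v k) k \<le> C * hnorm s r x * hnorm s r v"
    and N: "1 \<le> N" and p: "0 < p" "p \<le> 1 / 20" "p < d0"
  shows "cmod (exp (- \<i> * of_nat N * of_real (lim_speed N p * t)) - exp (- \<i> * of_nat N * of_real (real N ^ 3 * t)))
           \<le> 20 * C * p"
proof -
  let ?H = "Hhat s r" and ?n = "hnorm s r" and ?z = "\<lambda>_::int. 0::complex"
  obtain g V d H M where
    flow: "\<And>n. S (fourier_coeff (g n)) t = (\<lambda>k. exp (- \<i> * of_int k * of_real (V n * t)) * fourier_coeff (g n) k)"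
    and V: "V \<longlonglongrightarrow> lim_speed N p" and d: "\<And>n. 0 < d n" "d \<longlonglongrightarrow> 0" and M: "0 \<le> M"
    and gH: "\<And>n. fourier_coeff (g n) = (\<lambda>k. sgl 0 (of_real p) k + H n k)"
    and Hb: "\<And>n k. cmod (H n k) \<le> M * d n * jbr k powr (- s - 2)"
    and low: "\<forall>\<^sub>F n in sequentially. d n \<le> 2 * cmod (H n (int N))"
    and b1: "\<forall>\<^sub>F n in sequentially. cmod (H n (- int N)) \<le> cmod (H n (int N)) + M * d n ^ 2"
    and b2: "\<forall>\<^sub>F n in sequentially. \<forall>k. k \<noteq> int N \<longrightarrow> k \<noteq> - int N \<longrightarrow>
        cmod (H n k) \<le> M * d n ^ 2 * jbr k powr (- s - 2)"
    by (rule wave_family[OF N p(1,2), of "- s - 2"]) (rule that, use S t in blast)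
  obtain B where B: "0 < B" "\<And>u M. 0 \<le> M \<Longrightarrow> (\<And>k. cmod (u k) \<le> M * jbr k powr (- s - 2))
           \<Longrightarrow> u \<in> ?H \<and> ?n u \<le> B * M"
    by (rule Hhat_decay[OF r, of s]) (rule that, assumption, blast)
  have z: "?z \<in> ?H" by (rule zero_Hhat[OF r])
  have HH: "H n \<in> ?H" "?n (H n) \<le> B * (M * d n)" for n
    using B(2)[of "M * d n" "H n", OF _ Hb] M d(1)[of n] by simp_all
  define x where "x = sgl 0 (of_real p)"
  have x: "x \<in> ?H" "?n x = p" using sgl_Hhat[OF r, where s=s] p by (simp_all add: x_def jbr_def)
  define L where "L = D1 ?z"
  have L: "bounded_lin1 s r L" using D1[OF z] by (simp add: L_def)
  obtain C0 where C0: "0 \<le> C0" "\<And>v k. v \<in> ?H \<Longrightarrow> wt s (L v) k \<le> C0 * ?n v"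
    by (rule bounded_lin1_bound[OF r L]) (rule that)
  have Lsgl: "L (sgl k a) m = (if m = k then exp (- \<i> * of_int k * of_real (of_int k ^ 3 * t)) * a else 0)" for k a m
    using frechet[OF z] by (intro flow_derivative_at_0[OF r S t L]) (simp add: L_def)
  define J where "J = jbr (int N) powr s"
  have J: "0 < J" using jbr_pos[of "int N"] by (simp add: J_def)
  have wtN: "wt s u (int N) = J * cmod (u (int N))" for u by (simp add: wt_def J_def)
  define \<Phi> where "\<Phi> n = exp (- \<i> * of_nat N * of_real (V n * t))" for n
  define \<Psi> where "\<Psi> = exp (- \<i> * of_nat N * of_real (real N ^ 3 * t))"
  have N0: "int N \<noteq> 0" "int N \<noteq> - int N" using N by auto
  have main: "\<forall>\<^sub>F n in sequentially. cmod (\<Phi> n - \<Psi>) \<le>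
      (e + C * p) * (20 + 32 * (J * M + B * M) / J * d n) + 2 * C0 * B * M / J * d n" if e: "0 < e" for e
  proof -
    from frechet[OF x(1) e] obtain d1 where d1: "0 < d1" and fr: "\<And>h. h \<in> ?H \<Longrightarrow> ?n h < d1 \<Longrightarrow>
        wt s (\<lambda>k. S (\<lambda>j. x j + h j) t k - S x t k - D1 x h k) (int N) \<le> e * ?n h" by blast
    have "(\<lambda>n. B * (M * d n)) \<longlonglongrightarrow> B * (M * 0)" by (intro tendsto_intros d)
    then have "\<forall>\<^sub>F n in sequentially. B * (M * d n) < d1" using d1 by (simp add: order_tendstoD)
    with low b1 b2 show ?thesis
    proof eventually_elim
      case (elim n)
      define a where "a = H n (int N)"
      define b where "b = H n (- int N)"
      define R where "R k = (if k = int N \<or> k = - int N then 0 else H n k)" for k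
      have a: "d n \<le> 2 * cmod a" using elim by (simp add: a_def)
      have a0: "0 < cmod a" using a d(1)[of n] by linarith
      have R: "R \<in> ?H" "?n R \<le> B * (M * d n ^ 2)"
        using B(2)[of "M * d n ^ 2" R] M elim by (auto simp: R_def)
      have dec: "H n = (\<lambda>k. sgl (int N) a k + (sgl (- int N) b k + R k))"
        using N0 by (auto simp: sgl_def a_def b_def R_def)
      have s2: "(\<lambda>k. sgl (- int N) b k + R k) \<in> ?H"
        and s2n: "?n (\<lambda>k. sgl (- int N) b k + R k) \<le> 4 * (?n (sgl (- int N) b) + ?n R)"
        by (rule Hhat_add[OF r sgl_Hhat(1)[OF r] R(1)])+
      \<comment> \<open>The 20 is \<open>4 * (1 + 4)\<close>: two splittings, each costing a factor
        4, with mode \<open>- N\<close> counted as no larger than mode \<open>N\<close> up to second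
        order. In the second-order rest one factor \<open>d n\<close> is exchanged for
        \<open>2 * cmod a\<close>.\<close>
      have "?n (H n) \<le> 4 * (?n (sgl (int N) a) + ?n (\<lambda>k. sgl (- int N) b k + R k))"
        unfolding dec by (rule Hhat_add(2)[OF r sgl_Hhat(1)[OF r] s2])
      also have "\<dots> \<le> 4 * (J * cmod a + 4 * (J * cmod b + B * (M * d n ^ 2)))"
        using s2n R(2) by (simp add: sgl_Hhat(2)[OF r] J_def)
      also have "\<dots> \<le> 4 * (J * cmod a + 4 * (J * (cmod a + M * d n ^ 2) + B * (M * d n ^ 2)))"
        using elim J by (simp add: a_def b_def)
      also have "\<dots> = 20 * (J * cmod a) + 16 * (J * M + B * M) * d n * d n"
        by (simp add: algebra_simps power2_eq_square)
      also have "\<dots> \<le> 20 * (J * cmod a) + 16 * (J * M + B * M) * d n * (2 * cmod a)"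
        using a J M B(1) d(1)[of n] by (intro add_left_mono mult_left_mono) auto
      also have "\<dots> = (20 + 32 * (J * M + B * M) / J * d n) * (J * cmod a)"
        using J by (simp add: field_simps)
      finally have Hn: "?n (H n) \<le> (20 + 32 * (J * M + B * M) / J * d n) * (J * cmod a)" .
      have xH: "(\<lambda>j. x j + H n j) = fourier_coeff (g n)" by (simp add: gH x_def)
      have SxH: "S (\<lambda>j. x j + H n j) t (int N) = \<Phi> n * a"
        unfolding xH flow using N0 by (simp add: gH sgl_def \<Phi>_def a_def)
      have Sx: "S x t (int N) = 0"
        unfolding x_def flow_plane_wave[OF S t] using N0 by (simp add: sgl_def)
      \<comment> \<open>\<open>L\<close> is known explicitly on single modes: mode
        \<open>- N\<close> contributes nothing at \<open>N\<close>. The possibly infinite rest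
        \<open>R\<close> is handled only by boundedness of \<open>L\<close>; being of order
        \<open>d n ^ 2\<close>, it is negligible against \<open>a\<close>.\<close>
      have LH: "L (H n) (int N) = \<Psi> * a + L R (int N)"
      proof -
        have "L (H n) = (\<lambda>k. L (sgl (int N) a) k + (L (sgl (- int N) b) k + L R k))"
          unfolding dec bounded_lin1D(2)[OF L sgl_Hhat(1)[OF r] s2] bounded_lin1D(2)[OF L sgl_Hhat(1)[OF r] R(1)] ..
        then show ?thesis using N0 by (simp add: Lsgl \<Psi>_def)
      qed
      have 1: "J * cmod (\<Phi> n * a - D1 x (H n) (int N)) \<le> e * ?n (H n)"
        using fr[OF HH(1)[of n]] HH(2)[of n] elim by (simp add: wtN SxH Sx)
      have 2: "J * cmod (D1 x (H n) (int N) - L (H n) (int N)) \<le> C * p * ?n (H n)"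
        using lip[OF x(1) _ HH(1)[of n], of "int N"] x p by (simp add: wtN L_def)
      have 3: "J * cmod (L R (int N)) \<le> C0 * (B * (M * d n ^ 2))"
        using order_trans[OF C0(2)[OF R(1), of "int N"] mult_left_mono[OF R(2) C0(1)]] by (simp add: wtN)
      have "(\<Phi> n - \<Psi>) * a = (\<Phi> n * a - D1 x (H n) (int N)) + (D1 x (H n) (int N) - L (H n) (int N)) + L R (int N)"
        by (simp add: LH algebra_simps)
      then have "cmod ((\<Phi> n - \<Psi>) * a) \<le> cmod (\<Phi> n * a - D1 x (H n) (int N))
          + cmod (D1 x (H n) (int N) - L (H n) (int N)) + cmod (L R (int N))"
        by (simp only:) (meson add_right_mono norm_triangle_ineq order_trans)
      then have "J * (cmod (\<Phi> n - \<Psi>) * cmod a) \<le> J * (cmod (\<Phi> n * a - D1 x (H n) (int N))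
          + cmod (D1 x (H n) (int N) - L (H n) (int N)) + cmod (L R (int N)))"
        unfolding norm_mult using J by (intro mult_left_mono) auto
      also have "\<dots> \<le> (e + C * p) * ?n (H n) + C0 * (B * (M * d n ^ 2))"
        using 1 2 3 by (simp add: algebra_simps)
      also have "\<dots> \<le> (e + C * p) * ((20 + 32 * (J * M + B * M) / J * d n) * (J * cmod a)) + C0 * B * M * d n * (2 * cmod a)"
      proof (intro add_mono mult_left_mono Hn)
        show "0 \<le> e + C * p" using e C p by simp
        have "C0 * B * M * d n * d n \<le> C0 * B * M * d n * (2 * cmod a)"
          using a C0 B(1) M d(1)[of n] by (intro mult_left_mono) auto
        then show "C0 * (B * (M * d n ^ 2)) \<le> C0 * B * M * d n * (2 * cmod a)"
          by (simp add: power2_eq_square mult_ac)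
      qed
      also have "\<dots> = ((e + C * p) * (20 + 32 * (J * M + B * M) / J * d n) + 2 * C0 * B * M / J * d n) * (J * cmod a)"
        using J by (simp add: field_simps)
      finally have "cmod (\<Phi> n - \<Psi>) * (J * cmod a)
          \<le> ((e + C * p) * (20 + 32 * (J * M + B * M) / J * d n) + 2 * C0 * B * M / J * d n) * (J * cmod a)"
        by (simp add: mult_ac)
      then show ?case using J a0 by (subst (asm) mult_le_cancel_right_pos) simp_all
    qed
  qed
  define X where "X = cmod (exp (- \<i> * of_nat N * of_real (lim_speed N p * t)) - \<Psi>)"
  have l1: "(\<lambda>n. cmod (\<Phi> n - \<Psi>)) \<longlonglongrightarrow> X"
    unfolding \<Phi>_def X_def by (intro tendsto_intros V)
  have l2: "(\<lambda>n. (e + C * p) * (20 + 32 * (J * M + B * M) / J * d n) + 2 * C0 * B * M / J * d n)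
      \<longlonglongrightarrow> (e + C * p) * (20 + 32 * (J * M + B * M) / J * 0) + 2 * C0 * B * M / J * 0" for e
    by (intro tendsto_intros d)
  have le: "X \<le> 20 * C * p + 20 * e" if "0 < e" for e
    using tendsto_le[OF _ l2 l1 main[OF that]] by (simp add: algebra_simps)
  have "X \<le> 20 * C * p"
  proof (rule field_le_epsilon)
    show "X \<le> 20 * C * p + e" if "0 < e" for e using le[of "e / 20"] that by simp
  qed
  then show ?thesis by (simp add: X_def \<Psi>_def)
qed

theorem theorem3p7:
  fixes r :: ereal and s T :: real
  assumes "1 \<le> r" and "T > 0"
  shows "\<not> (\<exists>S. is_flow_map s r T S \<and>
               (\<forall>t\<in>{-T<..<T}. C3_on_Hhat s r (\<lambda>u0. S u0 t)))"
proof
  assume "\<exists>S. is_flow_map s r T S \<and> (\<forall>t\<in>{-T<..<T}. C3_on_Hhat s r (\<lambda>u0. S u0 t))"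
  then obtain S where S: "is_flow_map s r T S" and C3: "\<And>t. t \<in> {-T<..<T} \<Longrightarrow> C3_on_Hhat s r (\<lambda>u0. S u0 t)"
    by blast
  define t where "t = T / 2"
  have t: "t \<in> {-T<..<T}" and t0: "0 < t" using assms(2) by (auto simp: t_def)
  obtain D1 C d0 where
    D1: "\<And>x. x \<in> Hhat s r \<Longrightarrow> bounded_lin1 s r (D1 x)"
    and frechet: "\<And>x e. x \<in> Hhat s r \<Longrightarrow> 0 < e \<Longrightarrow> \<exists>d>0. \<forall>h\<in>Hhat s r. hnorm s r h < d \<longrightarrow>
        (\<forall>k. wt s (\<lambda>k. S (\<lambda>j. x j + h j) t k - S x t k - D1 x h k) k \<le> e * hnorm s r h)"
    and d0: "0 < d0" and C: "0 \<le> C"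
    and lip: "\<And>x v k. x \<in> Hhat s r \<Longrightarrow> hnorm s r x < d0 \<Longrightarrow> v \<in> Hhat s r \<Longrightarrow>
        wt s (\<lambda>k. D1 x v k - D1 (\<lambda>_. 0) v k) k \<le> C * hnorm s r x * hnorm s r v"
    by (rule C3_on_HhatE[OF assms(1) C3[OF t]]) (rule that)
  define p where "p N = sqrt (pi / (4 * t * real N ^ 3))" for N
  have p0: "p \<longlonglongrightarrow> 0" unfolding p_def[abs_def] using t0 by real_asymp
  have ev: "\<forall>\<^sub>F N in sequentially. 1 \<le> N \<and> 0 < p N \<and> p N \<le> 1 / 20 \<and> p N < d0"
  proof -
    have "\<forall>\<^sub>F N in sequentially. p N < 1 / 20" "\<forall>\<^sub>F N in sequentially. p N < d0"
      by (rule order_tendstoD(2)[OF p0], use d0 in simp)+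
    then show ?thesis using eventually_ge_at_top[of 1]
      by eventually_elim (use t0 in \<open>simp add: p_def\<close>)
  qed
  define \<theta> where "\<theta> N = real N * (lim_speed N (p N) * t) - real N * (real N ^ 3 * t)" for N
  have bound: "\<forall>\<^sub>F N in sequentially. cmod (exp (- \<i> * of_real (\<theta> N)) - 1) \<le> 20 * C * p N"
    using ev
  proof eventually_elim
    case (elim N)
    let ?A = "exp (- \<i> * of_nat N * of_real (lim_speed N (p N) * t))"
      and ?B = "exp (- \<i> * of_nat N * of_real (real N ^ 3 * t))"
    have "?A = ?B * exp (- \<i> * of_real (\<theta> N))"
      by (simp add: \<theta>_def algebra_simps flip: exp_add)
    then have "?A - ?B = ?B * (exp (- \<i> * of_real (\<theta> N)) - 1)" by (simp add: algebra_simps)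
    then have "cmod (?A - ?B) = cmod (exp (- \<i> * of_real (\<theta> N)) - 1)"
      by (simp add: norm_mult norm_exp_eq_Re)
    moreover have "cmod (?A - ?B) \<le> 20 * C * p N"
      by (rule phase_gap_bound[OF assms(1) S t D1 frechet C lip]; assumption?) (use elim in simp_all)
    ultimately show ?case by simp
  qed
  have "\<theta> \<longlonglongrightarrow> - pi"
  proof -
    define c where "c = pi / (4 * t)"
    have c: "0 < c" "t * c = pi / 4" using t0 by (simp_all add: c_def)
    \<comment> \<open>\<open>lim_speed\<close> contains \<open>p\<close> only through even powers
      once squares are expanded, so the square root is gone before the asymptotic expansion.\<close>
    have P: "p N ^ 2 = c / real N ^ 3" "p N ^ 4 = (c / real N ^ 3)^2" for N
    proof -
      have "0 \<le> pi / (4 * t * real N ^ 3)" using t0 by simp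
      then show *: "p N ^ 2 = c / real N ^ 3" by (simp add: p_def c_def)
      show "p N ^ 4 = (c / real N ^ 3)^2" unfolding *[symmetric] by (simp flip: power_mult)
    qed
    \<comment> \<open>Here \<open>\<tau>\<close> is about \<open>2 * N\<close> and \<open>v\<close>
      about \<open>N - 2 * p^2\<close>. Beyond \<open>N^3\<close>, the three terms of
      \<open>lim_speed\<close> contribute \<open>- 6\<close>, \<open>3\<close> and
      \<open>- 1\<close> times \<open>p^2 * N^2\<close>, altogether \<open>- 4\<close>; multiplied
      by \<open>N\<close>, this is \<open>- 4 * c\<close>.\<close>
    have "(\<lambda>N. real N * (lim_speed N (p N)) - real N * real N ^ 3) \<longlonglongrightarrow> - 4 * c"
      unfolding lim_speed_def Let_def power_mult_distrib power_divide P using c(1) by real_asymp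
    then have "(\<lambda>N. t * (real N * (lim_speed N (p N)) - real N * real N ^ 3)) \<longlonglongrightarrow> t * (- 4 * c)"
      by (intro tendsto_intros)
    moreover have "t * (- 4 * c) = - pi" using c(2) by simp
    ultimately show ?thesis unfolding \<theta>_def[abs_def] by (simp add: algebra_simps)
  qed
  then have l1: "(\<lambda>N. cmod (exp (- \<i> * of_real (\<theta> N)) - 1)) \<longlonglongrightarrow> cmod (exp (- \<i> * of_real (- pi)) - 1)"
    by (intro tendsto_intros)
  have l2: "(\<lambda>N. 20 * C * p N) \<longlonglongrightarrow> 20 * C * 0" by (intro tendsto_intros p0)
  \<comment> \<open>The left side is \<open>cmod (- 1 - 1) = 2\<close>, the right side is 0.\<close>
  have "cmod (exp (- \<i> * of_real (- pi)) - 1) \<le> 20 * C * 0"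
    by (rule tendsto_le[OF _ l2 l1 bound]) simp
  then show False by (simp add: exp_eq_polar mult.commute)
qed

end
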